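(* Let $n\ge 1$, let $D\subset\mathbb{C}^{n+1}$ be a domain with $0\in bD$, and assume that $0$ is an exponentially flat boundary point of $D$. Let $\alpha,N>0$ and let $\gamma$ be an $(\alpha,N)$-cone type stream approaching $0$. Let $d(t)$ and $d^*(t)$ denote the Euclidean distances from $\gamma(t)$ to $bD$ along the normal and the tangential directions, respectively. Then $$\lim_{t\to0^+}\frac{k_D(\gamma(t))}{d(t)^{-2}\,d^*(t)^{-2n}}=\frac14 .$$
   Context: Kobayashi--Eisenman volume element: for a domain $D\subset\mathbb{C}^{k}$ and $z\in D$, $k_D(z)=\inf\{|\det\psi'(0)|^{-2}:\psi:\mathbb{B}^{k}\to D\text{ holomorphic},\ \psi(0)=z\}$, with $\mathbb{B}^k$ the open unit ball of $\mathbb{C}^k$. Here $k=n+1$. Write points of $\mathbb{C}^{n+1}$ as $z=(z_1,z')$, $z'=(z_2,\dots,z_{n+1})\in\mathbb{C}^n$. Exponentially flat function: a smooth $\phi:\mathbb{R}\to\mathbb{R}$ is exponentially flat at the origin if (1) $\phi(x)=0$ for $x\le0$; (2) there is $\epsilon_0>0$ with $\phi''(x)>0$ for $0<x<\epsilon_0$; (3) the function $\psi(x)=-1/\log\phi(x)$ for $0<x<\epsilon_0$, $\psi(0)=0$, satisfies $\lim_{x\to0^+}\psi(x)/x^m=C$ for some $m,C>0$. Exponentially flat boundary point: $0\in bD$ is exponentially flat if there is a neighbourhood $U$ of $0$ such that $D\cap U=\{z\in U:\rho(z)<0\}$ with $\rho(z)=\operatorname{Re}z_1+\phi(|z_2|^2+\dots+|z_{n+1}|^2)$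 for some $\phi$ exponentially flat at the origin. Cone type stream: $C_{\alpha,N}=\{(z_1,z')\in\mathbb{C}\times\mathbb{C}^n:\operatorname{Re}z_1<-\alpha|z'|^N\}$. An $(\alpha,N)$-cone type stream approaching $0\in bD$ is a smooth curve $\gamma:(0,\epsilon_0)\to D\cap C_{\alpha,N}$ (some $\epsilon_0>0$) with $\lim_{t\to0^+}\gamma(t)=0$. Distances: for small $t$, let $\pi(t)\in bD$ be the boundary point nearest to $\gamma(t)$. Then $d(t)=|\gamma(t)-\pi(t)|$ is the distance from $\gamma(t)$ to $bD$ (attained along the normal direction at $\pi(t)$), and $d^*(t)$ is the Euclidean distance from $\gamma(t)$ to $bD$ within the affine complex hyperplane through $\gamma(t)$ parallel to the complex tangent space of $bD$ at $\pi(t)$. (For $\gamma(t)=(-t,0)$ this gives $d(t)=t$, $d^*(t)=\sqrt{\phi^{-1}(t)}$ for small $t$, where $\phi^{-1}$ is the inverse of $\phi$ on a small interval $[0,\epsilon_0)$.) *)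

theory Defs
  imports "HOL-Analysis.Analysis"
begin

text \<open>
  Complex space of dimension \<open>n + 1\<close> is \<open>complex ^ ('n option)\<close> with \<open>n = CARD('n) \<ge> 1\<close>:
  the index \<open>None\<close> carries \<open>z\<^sub>1\<close>, and the indices \<open>Some i\<close> carry \<open>z' = (z\<^sub>2, \<dots>, z\<^sub>n\<^sub>+\<^sub>1)\<close>.
  The norm on this type is the Euclidean norm.
\<close>

definition fst_coord :: "complex ^ ('n::finite option) \<Rightarrow> complex"
  where "fst_coord z = z $ None"

definition rest_coords :: "complex ^ ('n::finite option) \<Rightarrow> complex ^ 'n"
  where "rest_coords z = (\<chi> i. z $ Some i)"

text \<open>Infinitely often differentiable; meant for open sets \<open>I\<close>.\<close>

definition smooth_on :: "real set \<Rightarrow> (real \<Rightarrow> 'a::real_normed_vector) \<Rightarrow> bool"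
  where "smooth_on I f \<longleftrightarrow>
    (\<forall>k. \<forall>t\<in>I. ((\<lambda>g s. vector_derivative g (at s)) ^^ k) f differentiable (at t))"

text \<open>Real differentiable with complex-linear derivative; meant for open sets \<open>S\<close>.\<close>

definition holomorphic_map_on :: "(complex ^ 'k::finite) set \<Rightarrow> (complex ^ 'k \<Rightarrow> complex ^ 'm::finite) \<Rightarrow> bool"
  where "holomorphic_map_on S f \<longleftrightarrow>
    (\<forall>z\<in>S. \<exists>f'. (f has_derivative f') (at z) \<and> Vector_Spaces.linear (*s) (*s) f')"

text \<open>
  Maps with vanishing Jacobian determinant at \<open>0\<close> contribute \<open>+\<infinity>\<close> to the infimum and are
  therefore left out (in HOL, \<open>inverse 0 = 0\<close>). For open \<open>D\<close> and \<open>z \<in> D\<close> the remaining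
  set of values is nonempty.
\<close>

definition kobayashi_eisenman :: "(complex ^ 'k::finite) set \<Rightarrow> complex ^ 'k \<Rightarrow> real"
  where "kobayashi_eisenman D z =
    Inf {cmod (det (jacobian \<psi> (at 0))) powi (-2) | \<psi>.
      holomorphic_map_on (ball 0 1) \<psi> \<and> \<psi> ` ball 0 1 \<subseteq> D \<and> \<psi> 0 = z \<and>
      det (jacobian \<psi> (at 0)) \<noteq> 0}"

definition exponentially_flat :: "(real \<Rightarrow> real) \<Rightarrow> bool"
  where "exponentially_flat \<phi> \<longleftrightarrow>
    smooth_on UNIV \<phi> \<and>
    (\<forall>x\<le>0. \<phi> x = 0) \<and>
    (\<exists>\<epsilon>\<^sub>0>0. \<forall>x. 0 < x \<and> x < \<epsilon>\<^sub>0 \<longrightarrow> deriv (deriv \<phi>) x > 0) \<and>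
    (\<exists>m>0. \<exists>C>0. ((\<lambda>x. (- 1 / ln (\<phi> x)) / x powr m) \<longlongrightarrow> C) (at_right 0))"

definition exponentially_flat_boundary_point :: "(complex ^ ('n::finite option)) set \<Rightarrow> bool"
  where "exponentially_flat_boundary_point D \<longleftrightarrow>
    0 \<in> frontier D \<and>
    (\<exists>U \<phi>. open U \<and> 0 \<in> U \<and> exponentially_flat \<phi> \<and>
      D \<inter> U = {z \<in> U. Re (fst_coord z) + \<phi> (\<Sum>i\<in>UNIV. (cmod (rest_coords z $ i))\<^sup>2) < 0})"

definition cone :: "real \<Rightarrow> real \<Rightarrow> (complex ^ ('n::finite option)) set"
  where "cone \<alpha> N = {z. Re (fst_coord z) < - \<alpha> * norm (rest_coords z) powr N}"

definition cone_type_stream ::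
    "(complex ^ ('n::finite option)) set \<Rightarrow> real \<Rightarrow> real \<Rightarrow> (real \<Rightarrow> complex ^ ('n option)) \<Rightarrow> bool"
  where "cone_type_stream D \<alpha> N \<gamma> \<longleftrightarrow>
    (\<exists>\<epsilon>\<^sub>0>0. smooth_on {0<..<\<epsilon>\<^sub>0} \<gamma> \<and> \<gamma> ` {0<..<\<epsilon>\<^sub>0} \<subseteq> D \<inter> cone \<alpha> N) \<and>
    (\<gamma> \<longlongrightarrow> 0) (at_right 0)"

text \<open>
  Velocities at \<open>p\<close> of curves in \<open>S\<close> through \<open>p\<close>. Where \<open>S\<close> is a \<open>C\<^sup>1\<close> hypersurface with
  defining function \<open>\<rho>\<close>, this is the kernel of the differential of \<open>\<rho>\<close> at \<open>p\<close>.
\<close>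

definition tangent_space :: "'a::real_normed_vector set \<Rightarrow> 'a \<Rightarrow> 'a set"
  where "tangent_space S p =
    {v. \<exists>c. c 0 = p \<and> (c has_vector_derivative v) (at (0::real)) \<and> (\<forall>\<^sub>F s in at 0. c s \<in> S)}"

definition complex_tangent_space :: "(complex ^ 'k::finite) set \<Rightarrow> complex ^ 'k \<Rightarrow> (complex ^ 'k) set"
  where "complex_tangent_space S p = {v \<in> tangent_space S p. \<i> *s v \<in> tangent_space S p}"

text \<open>
  In both distances \<open>closest_point (frontier D) z\<close> is the nearest boundary point. It always exists
  when the boundary is nonempty, and it is unique for \<open>z\<close> close to a point where the boundary is
  \<open>C\<^sup>2\<close>. Near an exponentially flat point the slice of the boundary in \<open>tangential_distance\<close> is
  nonempty, so the value \<open>0\<close> of \<open>infdist\<close> on the empty set does not interfere.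
\<close>

definition normal_distance :: "(complex ^ 'k::finite) set \<Rightarrow> complex ^ 'k \<Rightarrow> real"
  where "normal_distance D z = dist z (closest_point (frontier D) z)"

definition tangential_distance :: "(complex ^ 'k::finite) set \<Rightarrow> complex ^ 'k \<Rightarrow> real"
  where "tangential_distance D z =
    infdist z (frontier D \<inter>
      {z + v | v. v \<in> complex_tangent_space (frontier D) (closest_point (frontier D) z)})"

end

theory Submission
  imports Defs "HOL-Complex_Analysis.Riemann_Mapping" "HOL-Real_Asymp.Real_Asymp"
begin

text \<open>
  Put \<open>x = - Re z\<^sub>1\<close> and let \<open>R > 0\<close> be the number with \<open>\<phi>(R\<^sup>2) = x\<close>. Exponential flatness means that
  \<open>\<phi>\<close> grows so abruptly that \<open>\<phi>(l y) / \<phi>(y)\<close> tends to \<open>0\<close> for every \<open>l < 1\<close>; hence all heights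
  comparable with \<open>x\<close> are reached at radii \<open>|z'|\<close> asymptotic to one and the same \<open>R\<close>. Seen from \<open>z\<close>, the domain is
  therefore nearly the product of the half-plane \<open>Re z\<^sub>1 < 0\<close> and a ball of radius \<open>R\<close>, whose volume element at
  a point of height \<open>-x\<close> over the centre of the ball is exactly \<open>1 / (4 x\<^sup>2 R\<^sup>2\<^sup>n)\<close>. The cone condition
  makes \<open>|z'|\<close> smaller than \<open>R\<^sup>2\<close>, because \<open>\<phi>\<close> vanishes to infinite order, so the points of the stream
  do lie over the centre; and then \<open>d\<close> is asymptotic to \<open>x\<close> and \<open>d\<^sup>*\<close> to \<open>R\<close>
  (lemmas \<open>normal_distance_asymp\<close> and \<open>tangential_distance_asymp\<close>). The distance \<open>d\<^sup>*\<close> is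
  measured in a complex hyperplane whose slope, governed by \<open>\<phi>'\<close> at radii much below \<open>R\<close>, is negligible.

  The upper bound for the volume element comes from an explicit map into \<open>D\<close>, the product of a Moebius map
  into a half-plane and a homothety (\<open>kobayashi_competitor\<close>).

  For the lower bound (\<open>kobayashi_det_bound\<close>) let \<open>\<psi>\<close> be any competitor. Restricted to a ball of radius \<open>r < 1\<close>
  it stays near \<open>0\<close>, where \<open>Re z\<^sub>1 < 0\<close>. The Schwarz lemma for the half-plane bounds the gradient of \<open>\<psi>\<^sub>1\<close>
  by \<open>2 x / r\<close>, and the Harnack inequality keeps \<open>- Re \<psi>\<^sub>1\<close> below a constant multiple of \<open>x\<close> on a smaller
  ball. There \<open>|\<psi>'|\<close> is at most \<open>(1 + \<theta>) R\<close>, so Cauchy's estimate bounds the gradients of the other components,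
  and Hadamard's determinant inequality combines the bounds of the rows.

  That competitors stay near \<open>0\<close> needs an argument, since away from \<open>0\<close> the domain is arbitrary, possibly
  unbounded and containing entire curves. The function \<open>Re (z\<^sub>1 + z\<^sub>1\<^sup>2)\<close> is a local peak function: it vanishes at \<open>0\<close>
  and is negative at all other points of the closure of \<open>D\<close> near \<open>0\<close>. If a disc \<open>f\<close> starts close to \<open>0\<close>, the
  component \<open>\<Omega>\<close> of \<open>{|f| < s}\<close> around the centre has an exit boundary of small harmonic measure. By the maximum
  principle \<open>\<Omega>\<close> is simply connected, so an exit at a point \<open>\<zeta>\<close> of modulus \<open>\<le> r\<close> permits a holomorphic
  square root of the Moebius map with zero \<open>\<zeta>\<close>, and comparing this root with the peak function, as in Milloux's
  estimate of harmonic measure, gives a contradiction (\<open>disc_stays_near_peak_point\<close>).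
\<close>

section \<open>Hadamard's determinant inequality\<close>

lemma of_real_norm_vec_square:
  fixes v :: "complex ^ 'n::finite"
  shows "of_real ((norm v)\<^sup>2) = (\<Sum>j\<in>UNIV. v $ j * cnj (v $ j))"
proof -
  have "(norm v)\<^sup>2 = (\<Sum>j\<in>UNIV. (cmod (v $ j))\<^sup>2)"
    by (simp add: norm_vec_def L2_set_def sum_nonneg)
  then show ?thesis by (simp only: of_real_sum complex_norm_square)
qed

lemma norm_vector_scalar_mult:
  fixes v :: "complex ^ 'n::finite"
  shows "norm (c *s v) = cmod c * norm v"
proof -
  have "norm (c *s v) = sqrt ((cmod c)\<^sup>2 * (\<Sum>i\<in>UNIV. (cmod (v $ i))\<^sup>2))"
    by (simp add: norm_vec_def L2_set_def norm_mult power_mult_distrib sum_distrib_left)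
  then show ?thesis by (simp add: real_sqrt_mult norm_vec_def L2_set_def)
qed

lemma det_cnj_transpose:
  fixes A :: "complex ^ 'n::finite ^ 'n"
  shows "det (\<chi> i j. cnj (A $ j $ i)) = cnj (det A)"
proof -
  have "det (\<chi> i j. cnj (A $ j $ i)) = det (transpose (\<chi> i j. cnj (A $ j $ i)))"
    by simp
  also have "\<dots> = cnj (det A)"
    unfolding det_def by (simp add: transpose_def)
  finally show ?thesis .
qed

text \<open>
  Among matrices with rows in the unit ball, which form a compact set, consider one that maximises \<open>|det|\<close>. Adding a multiple
  of a row to another one keeps the determinant, so by maximality it cannot shorten the latter; hence
  the rows are orthonormal, the matrix is unitary, and its determinant has modulus 1.
\<close>

lemma Hadamard_det_le_1:
  fixes A :: "complex ^ 'n::finite ^ 'n"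
  assumes "\<And>i. norm (A $ i) \<le> 1"
  shows "cmod (det A) \<le> 1"
proof -
  define S where "S = {B :: complex ^ 'n ^ 'n. \<forall>i. norm (B $ i) \<le> 1}"
  have "bounded S"
  proof -
    have "norm B \<le> real CARD('n)" if "B \<in> S" for B
    proof -
      have "norm B \<le> (\<Sum>i\<in>UNIV. norm (B $ i))"
        unfolding norm_vec_def[of B] by (rule L2_set_le_sum) simp
      also have "\<dots> \<le> real CARD('n)"
        using sum_bounded_above[of UNIV "\<lambda>i. norm (B $ i)" 1] that by (simp add: S_def)
      finally show ?thesis .
    qed
    then show ?thesis by (auto simp: bounded_iff)
  qed
  moreover have "closed S"
    unfolding S_def by (intro closed_Collect_all closed_Collect_le continuous_intros)
  ultimately have "compact S" by (simp add: compact_eq_bounded_closed)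
  have contdet: "continuous_on S (\<lambda>B. cmod (det B))"
    unfolding det_def by (intro continuous_intros)
  have one: "mat 1 \<in> S"
  proof -
    have "mat 1 $ i = (axis i 1 :: complex ^ 'n)" for i
      by (simp add: mat_def axis_def vec_eq_iff)
    then show ?thesis unfolding S_def by (simp add: norm_axis_1)
  qed
  then obtain B where B: "B \<in> S" and max: "\<And>C. C \<in> S \<Longrightarrow> cmod (det C) \<le> cmod (det B)"
    using continuous_attains_sup[OF \<open>compact S\<close> _ contdet] by blast
  define M where "M = cmod (det B)"
  have "M \<ge> 1" using max[OF one] by (simp add: M_def)
  \<comment> \<open>homogeneity of the determinant in one row\<close>
  have step1: "cmod (det (\<chi> k. if k = i then w else B $ k)) \<le> M * norm w" for i w
  proof (cases "w = 0")
    case True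
    have "row i (\<chi> k. if k = i then 0 else B $ k) = 0" by (simp add: row_def vec_eq_iff)
    then show ?thesis using True det_zero_row(1) by (metis norm_zero mult_zero_right order_refl)
  next
    case False
    define u where "u = inverse (complex_of_real (norm w)) *s w"
    have w: "w = complex_of_real (norm w) *s u" using False by (simp add: u_def)
    have "norm u = 1"
      using False by (simp add: u_def norm_vector_scalar_mult norm_inverse)
    then have "(\<chi> k. if k = i then u else B $ k) \<in> S"
      using B by (simp add: S_def)
    from max[OF this] have "cmod (det (\<chi> k. if k = i then u else B $ k)) \<le> M" by (simp add: M_def)
    moreover have "det (\<chi> k. if k = i then w else B $ k)
        = complex_of_real (norm w) * det (\<chi> k. if k = i then u else B $ k)"
      using det_row_mul[of i "complex_of_real (norm w)" "\<lambda>_. u" "\<lambda>k. B $ k"] w by metis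
    ultimately show ?thesis by (simp add: norm_mult mult.commute[of M] mult_left_mono)
  qed
  have eqB: "(\<chi> k. if k = i then B $ i else B $ k) = B" for i by (simp add: vec_eq_iff)
  have rows: "norm (B $ i) = 1" for i
  proof -
    have "M \<le> M * norm (B $ i)" using step1[of i "B $ i"] by (simp only: eqB M_def)
    with \<open>M \<ge> 1\<close> have "1 \<le> norm (B $ i)" by simp
    with B show ?thesis by (simp add: S_def order_antisym)
  qed
  \<comment> \<open>row operations cannot make a row shorter than 1\<close>
  have step3: "1 \<le> norm (B $ i + c *s B $ k)" if "i \<noteq> k" for i k c
  proof -
    have "det (\<chi> l. if l = i then B $ i + c *s B $ k else B $ l) = det B"
      using det_row_operation[OF that, of B c] by (simp add: row_def vec_lambda_eta cong: if_cong)
    with step1[of i "B $ i + c *s B $ k"] have "M \<le> M * norm (B $ i + c *s B $ k)"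
      by (simp add: M_def)
    with \<open>M \<ge> 1\<close> show ?thesis by simp
  qed
  have sq: "(\<Sum>j\<in>UNIV. B $ i $ j * cnj (B $ i $ j)) = 1" for i
    using of_real_norm_vec_square[of "B $ i"] rows[of i] by simp
  have orth: "(\<Sum>j\<in>UNIV. B $ i $ j * cnj (B $ k $ j)) = 0" if "i \<noteq> k" for i k
  proof -
    define h where "h = (\<Sum>j\<in>UNIV. B $ i $ j * cnj (B $ k $ j))"
    have h': "(\<Sum>j\<in>UNIV. B $ k $ j * cnj (B $ i $ j)) = cnj h"
      by (simp add: h_def mult.commute)
    \<comment> \<open>subtracting the projection of row i onto row k would shorten row i unless h = 0\<close>
    let ?v = "B $ i + (- h) *s B $ k"
    have "of_real ((norm ?v)\<^sup>2) = (\<Sum>j\<in>UNIV. B $ i $ j * cnj (B $ i $ j)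
       - cnj h * (B $ i $ j * cnj (B $ k $ j)) - h * (B $ k $ j * cnj (B $ i $ j))
       + h * cnj h * (B $ k $ j * cnj (B $ k $ j)))"
      unfolding of_real_norm_vec_square by (intro sum.cong) (auto simp: algebra_simps)
    also have "\<dots> = 1 - cnj h * h - h * cnj h + h * cnj h * 1"
      unfolding sum.distrib sum_subtractf sum_distrib_left[symmetric] sq h' h_def[symmetric] ..
    also have "\<dots> = of_real (1 - (cmod h)\<^sup>2)" unfolding of_real_diff complex_norm_square by (simp add: mult.commute)
    finally have "(norm ?v)\<^sup>2 = 1 - (cmod h)\<^sup>2" by (simp only: of_real_eq_iff)
    moreover have "1 \<le> (norm ?v)\<^sup>2" using step3[OF that, of "-h"] by (simp only: one_le_power)
    ultimately show ?thesis by (simp add: h_def[symmetric])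
  qed
  have "B ** (\<chi> i j. cnj (B $ j $ i)) = mat 1"
    by (simp add: matrix_matrix_mult_def mat_def vec_eq_iff sq orth)
  then have "det B * cnj (det B) = 1"
    by (metis det_mul det_I det_cnj_transpose)
  then have "(cmod (det B))\<^sup>2 = 1"
    by (metis complex_norm_square of_real_eq_1_iff)
  then have "cmod (det B) = 1" by (simp add: power2_eq_1_iff) (smt (verit) norm_ge_zero)
  then show ?thesis using max[of A] assms by (simp add: S_def)
qed

lemma Hadamard_det_bound:
  fixes A :: "complex ^ 'n::finite ^ 'n"
  shows "cmod (det A) \<le> (\<Prod>i\<in>UNIV. norm (A $ i))"
proof (cases "\<exists>i. A $ i = 0")
  case True
  then obtain i where "row i A = 0" by (auto simp: row_def vec_lambda_eta)
  then have "det A = 0" by (rule det_zero_row(1))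
  then show ?thesis by (simp add: prod_nonneg)
next
  case False
  define C where "C = (\<chi> i. inverse (complex_of_real (norm (A $ i))) *s A $ i)"
  have "norm (C $ i) = 1" for i
    using False by (simp add: C_def norm_vector_scalar_mult norm_inverse)
  then have "cmod (det C) \<le> 1" by (intro Hadamard_det_le_1) simp
  moreover have "A = (\<chi> i. complex_of_real (norm (A $ i)) *s C $ i)"
    using False by (simp add: C_def vec_eq_iff)
  then have "det A = (\<Prod>i\<in>UNIV. complex_of_real (norm (A $ i))) * det (\<chi> i. C $ i)"
    by (metis det_rows_mul)
  then have "cmod (det A) = (\<Prod>i\<in>UNIV. norm (A $ i)) * cmod (det C)"
    by (simp add: norm_mult prod_norm[symmetric] vec_lambda_eta)
  ultimately show ?thesis by (simp add: mult_left_le prod_nonneg)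
qed

section \<open>A maximum principle with boundary limits\<close>

text \<open>
  The function need not extend to the boundary: it suffices that its values do not exceed \<open>B\<close> in the limit there.
  A value above \<open>B\<close> would make the corresponding superlevel set compact, and the function constant.
\<close>

lemma maximum_modulus_limsup:
  fixes G :: "complex \<Rightarrow> complex"
  assumes hol: "G holomorphic_on S" and S: "open S" "connected S" "bounded S"
    and bdry: "\<And>p e. p \<in> frontier S \<Longrightarrow> e > 0 \<Longrightarrow> \<forall>\<^sub>F z in at p within S. cmod (G z) < B + e"
    and z0: "z0 \<in> S"
  shows "cmod (G z0) \<le> B"
proof (rule ccontr)
  assume "\<not> ?thesis"
  then have gt: "cmod (G z0) > B" by simp
  define K where "K = {z \<in> S. cmod (G z) \<ge> cmod (G z0)}"
  have contG: "continuous_on S G" using hol by (rule holomorphic_on_imp_continuous_on)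
  have away: "\<forall>\<^sub>F z in at p within S. cmod (G z) < cmod (G z0)" if "p \<in> frontier S" for p
    using bdry[OF that, of "cmod (G z0) - B"] gt by simp
  have "closed K"
    unfolding closed_limpt
  proof (intro allI impI)
    fix p assume lp: "p islimpt K"
    have "p \<in> closure S"
    proof -
      have "K \<subseteq> S" by (auto simp: K_def)
      with lp have "p islimpt S" by (rule islimpt_subset)
      then show ?thesis by (simp add: closure_def)
    qed
    have "p \<in> S"
    proof (rule ccontr)
      assume "p \<notin> S"
      with \<open>p \<in> closure S\<close> S(1) have "p \<in> frontier S" by (simp add: frontier_def interior_open)
      from away[OF this] obtain U where U: "open U" "p \<in> U" "\<And>z. z \<in> U \<Longrightarrow> z \<noteq> p \<Longrightarrow> z \<in> S \<Longrightarrow> cmod (G z) < cmod (G z0)"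
        by (auto simp: eventually_at_topological)
      then obtain z where "z \<in> K" "z \<in> U" "z \<noteq> p" using lp by (meson islimptE)
      with U show False by (force simp: K_def)
    qed
    show "p \<in> K"
    proof (rule ccontr)
      assume "p \<notin> K"
      with \<open>p \<in> S\<close> have lt: "cmod (G p) < cmod (G z0)" by (auto simp: K_def)
      have "continuous (at p) G" using contG S(1) \<open>p \<in> S\<close> by (simp add: continuous_on_eq_continuous_at)
      then have "((\<lambda>z. cmod (G z)) \<longlongrightarrow> cmod (G p)) (at p)"
        by (simp add: continuous_at tendsto_norm)
      then have "\<forall>\<^sub>F z in at p. cmod (G z) < cmod (G z0)" using lt by (rule order_tendstoD)
      then obtain U where U: "open U" "p \<in> U" "\<And>z. z \<in> U \<Longrightarrow> z \<noteq> p \<Longrightarrow> cmod (G z) < cmod (G z0)"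
        by (auto simp: eventually_at_topological)
      then obtain z where "z \<in> K" "z \<in> U" "z \<noteq> p" using lp by (meson islimptE)
      with U show False by (force simp: K_def)
    qed
  qed
  moreover have "bounded K" using S(3) by (rule bounded_subset) (auto simp: K_def)
  ultimately have "compact K" by (simp add: compact_eq_bounded_closed)
  moreover have "z0 \<in> K" using z0 by (simp add: K_def)
  moreover have "continuous_on K (\<lambda>z. cmod (G z))"
    using contG by (intro continuous_intros) (auto intro: continuous_on_subset simp: K_def)
  ultimately obtain w where w: "w \<in> K" "\<And>z. z \<in> K \<Longrightarrow> cmod (G z) \<le> cmod (G w)"
    using continuous_attains_sup[of K "\<lambda>z. cmod (G z)"] by blast
  have "cmod (G z) \<le> cmod (G w)" if "z \<in> S" for z
  proof (cases "z \<in> K")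
    case False
    then show ?thesis using w(1) that by (auto simp: K_def)
  qed (rule w(2))
  then have "G constant_on S"
    using maximum_modulus_principle[OF hol S(1,2) S(1) order_refl] w(1) by (auto simp: K_def)
  then have const: "G z = G z0" if "z \<in> S" for z
    using that z0 by (metis constant_on_def)
  have "frontier S \<noteq> {}"
    using z0 S(3) by (metis frontier_not_empty empty_iff not_bounded_UNIV)
  then obtain p where p: "p \<in> frontier S" by blast
  then have "p islimpt S" using S(1) by (auto simp: frontier_def closure_def interior_open)
  then have "at p within S \<noteq> bot" by (simp add: trivial_limit_within)
  moreover have "\<forall>\<^sub>F z in at p within S. False"
    using away[OF p] unfolding eventually_at_filter by eventually_elim (use const in force)
  ultimately show False by simp
qed

section \<open>Holomorphic maps from a disc to a half-plane\<close>

text \<open>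
  Both estimates are the Schwarz lemma for the composition of \<open>f\<close> with the Cayley transform that sends the half-plane to the disc
  and \<open>f 0\<close> to \<open>0\<close>.
\<close>

lemma half_plane_Schwarz:
  fixes f :: "complex \<Rightarrow> complex"
  assumes hol: "f holomorphic_on ball 0 r" and "r > 0"
    and neg: "\<And>z. z \<in> ball 0 r \<Longrightarrow> Re (f z) < 0"
  shows half_plane_deriv_bound: "cmod (deriv f 0) \<le> 2 * (- Re (f 0)) / r"
    and half_plane_Harnack: "\<And>z. z \<in> ball 0 r \<Longrightarrow>
      - Re (f z) \<le> (- Re (f 0)) * ((r + cmod z) / (r - cmod z))"
proof -
  define a where "a = f 0"
  have a: "Re a < 0" using neg[of 0] \<open>r > 0\<close> by (simp add: a_def)
  define T where "T = (\<lambda>w. (w - a) / (w + cnj a))"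
  have nz: "w + cnj a \<noteq> 0" if "Re w < 0" for w
    using that a by (metis add_neg_neg cnj.sel(1) less_irrefl plus_complex.sel(1) zero_complex.sel(1))
  define F where "F = (\<lambda>z. T (f (of_real r * z)))"
  have dom: "of_real r * z \<in> ball 0 r" if "cmod z < 1" for z :: complex
    using that \<open>r > 0\<close> by (simp add: norm_mult)
  have holf: "(\<lambda>z. f (of_real r * z)) holomorphic_on ball 0 1"
    using holomorphic_on_compose_gen[OF _ hol, of "\<lambda>z. of_real r * z" "ball 0 1"] dom
    by (force simp: o_def intro!: holomorphic_intros)
  have holF: "F holomorphic_on ball 0 1"
    unfolding F_def T_def using dom neg nz by (intro holomorphic_intros holf) auto
  have F0: "F 0 = 0" by (simp add: F_def T_def a_def)
  have Tlt: "cmod (T w) < 1" if "Re w < 0" for w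
  proof -
    have "(cmod (w - a))\<^sup>2 < (cmod (w + cnj a))\<^sup>2"
      using that a unfolding cmod_power2 by (simp add: power2_eq_square algebra_simps mult_neg_neg)
    then have "cmod (w - a) < cmod (w + cnj a)" by (rule power2_less_imp_less) simp
    then show ?thesis using nz[OF that] by (simp add: T_def norm_divide)
  qed
  have F1: "cmod (F z) < 1" if "cmod z < 1" for z
    using Tlt neg dom[OF that] by (auto simp: F_def)
  note SL = Schwarz_Lemma[OF holF F0 F1]
  have fd: "(f has_field_derivative deriv f 0) (at 0)"
    using hol \<open>r > 0\<close> by (simp add: holomorphic_derivI)
  have "(F has_field_derivative deriv f 0 * of_real r / (a + cnj a)) (at 0)"
  proof -
    have "(f has_field_derivative deriv f 0) (at (of_real r * 0))" using fd by simp
    then have *: "((\<lambda>z. f (of_real r * z)) has_field_derivative deriv f 0 * of_real r) (at 0)"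
      by (rule DERIV_chain2) (auto intro!: derivative_eq_intros)
    have "a + cnj a \<noteq> 0" using nz[OF a] .
    then have "((\<lambda>z. (f (of_real r * z) - a) / (f (of_real r * z) + cnj a)) has_field_derivative
        (((deriv f 0 * of_real r - 0) * (f (of_real r * 0) + cnj a)
          - (f (of_real r * 0) - a) * (deriv f 0 * of_real r + 0))
        / ((f (of_real r * 0) + cnj a) * (f (of_real r * 0) + cnj a)))) (at 0)"
      by (intro DERIV_divide DERIV_diff DERIV_add DERIV_const *) (simp add: a_def)
    then show ?thesis unfolding F_def T_def
      using \<open>a + cnj a \<noteq> 0\<close> by (simp flip: a_def)
  qed
  then have "deriv F 0 = deriv f 0 * of_real r / (a + cnj a)" by (rule DERIV_imp_deriv)
  moreover have "cmod (deriv F 0) \<le> 1" using SL(2)[of 0] by simp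
  moreover have "cmod (a + cnj a) = 2 * (- Re a)"
    using a by (simp add: complex_add_cnj norm_mult)
  ultimately show "cmod (deriv f 0) \<le> 2 * (- Re (f 0)) / r"
    using a \<open>r > 0\<close> by (simp add: norm_divide norm_mult field_simps flip: a_def)
  show "- Re (f z) \<le> (- Re (f 0)) * ((r + cmod z) / (r - cmod z))" if "z \<in> ball 0 r" for z
  proof -
    define w where "w = f z"
    define \<rho> where "\<rho> = cmod z / r"
    have w: "Re w < 0" using neg that by (simp add: w_def)
    have zr: "cmod (z / of_real r) < 1" using that \<open>r > 0\<close> by (simp add: norm_divide)
    have le: "cmod (T w) \<le> \<rho>"
      using SL(1)[OF _ zr] zr \<open>r > 0\<close> by (simp add: F_def w_def \<rho>_def norm_divide)
    have \<rho>: "0 \<le> \<rho>" "\<rho> < 1" using that \<open>r > 0\<close> by (auto simp: \<rho>_def)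
    \<comment> \<open>the bound on T w confines w to a hyperbolic disc around a; the imaginary parts only help\<close>
    have "cmod (w - a) \<le> \<rho> * cmod (w + cnj a)"
      using le nz[OF w] by (simp add: T_def norm_divide divide_le_eq)
    then have "(cmod (w - a))\<^sup>2 \<le> (\<rho> * cmod (w + cnj a))\<^sup>2"
      by (rule power_mono) simp
    then have ineq: "(Re w - Re a)\<^sup>2 + (Im w - Im a)\<^sup>2 \<le> \<rho>\<^sup>2 * ((Re w + Re a)\<^sup>2 + (Im w - Im a)\<^sup>2)"
      by (simp add: power_mult_distrib cmod_power2)
    have "\<rho>\<^sup>2 * (Im w - Im a)\<^sup>2 \<le> 1 * (Im w - Im a)\<^sup>2"
      using \<rho> by (intro mult_right_mono) (auto simp: power_le_one)
    with ineq have "(Re w - Re a)\<^sup>2 \<le> (\<rho> * (Re w + Re a))\<^sup>2"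
      unfolding power_mult_distrib[of \<rho>] distrib_left[of "\<rho>\<^sup>2"] by linarith
    then have "\<bar>Re w - Re a\<bar> \<le> \<bar>\<rho> * (Re w + Re a)\<bar>" by (simp add: abs_le_square_iff)
    also have "\<dots> = \<rho> * (- Re w - Re a)" using \<rho> w a by (simp add: abs_mult)
    finally have "- Re w + Re a \<le> \<rho> * (- Re w - Re a)" by linarith
    then have "- Re w * (1 - \<rho>) \<le> - Re a * (1 + \<rho>)" by (simp add: algebra_simps)
    then have "- Re w \<le> - Re a * ((1 + \<rho>) / (1 - \<rho>))"
      using \<rho> by (simp add: field_simps)
    moreover have "(1 + \<rho>) / (1 - \<rho>) = (r + cmod z) / (r - cmod z)"
      using \<open>r > 0\<close> that by (simp add: \<rho>_def field_simps)
    ultimately show ?thesis by (simp add: w_def a_def)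
  qed
qed

section \<open>Discs that start near a peak point\<close>

lemma norm_sum_mult_cnj_le:
  fixes u v :: "complex ^ 'k::finite"
  shows "cmod (\<Sum>j\<in>UNIV. u $ j * cnj (v $ j)) \<le> norm u * norm v"
proof -
  have "cmod (\<Sum>j\<in>UNIV. u $ j * cnj (v $ j)) \<le> (\<Sum>j\<in>UNIV. \<bar>cmod (u $ j)\<bar> * \<bar>cmod (v $ j)\<bar>)"
    by (rule order_trans[OF norm_sum]) (simp add: norm_mult)
  also have "\<dots> \<le> norm u * norm v"
    unfolding norm_vec_def by (rule L2_set_mult_ineq)
  finally show ?thesis .
qed

text \<open>
  The maximum principle forbids holes: if a loop lies in \<open>{|f| < s}\<close>, so does its inside. This is where it matters that \<open>f\<close>
  takes its values in a vector space.
\<close>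

lemma simply_connected_sublevel_component:
  fixes f :: "complex \<Rightarrow> complex ^ 'k::finite" and s :: real
  assumes hol: "\<And>j. (\<lambda>z. f z $ j) holomorphic_on V" and V: "open V" "convex V"
  defines "W \<equiv> {z \<in> V. norm (f z) < s}"
  shows "open W" and "simply_connected (connected_component_set W a)"
proof -
  have contf: "continuous_on V f"
    using hol by (intro continuous_on_vec_lambda[where f="\<lambda>j z. f z $ j", simplified]) (simp add: holomorphic_on_imp_continuous_on)
  have "W = V \<inter> (\<lambda>z. norm (f z)) -` {..<s}" by (auto simp: W_def)
  then show "open W"
    using contf V(1) by (metis continuous_on_norm continuous_open_preimage open_lessThan)
  define \<Omega> where "\<Omega> = connected_component_set W a"
  have "open \<Omega>" unfolding \<Omega>_def using \<open>open W\<close> by (rule open_connected_component)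
  have sub: "\<Omega> \<subseteq> W" by (simp add: \<Omega>_def connected_component_subset)
  have "winding_number g z = 0"
    if g: "path g" "path_image g \<subseteq> \<Omega>" "pathfinish g = pathstart g" "z \<notin> \<Omega>" for g z
  proof -
    define I where "I = inside (path_image g)"
    have cp: "compact (path_image g)" using g(1) by (rule compact_path_image)
    have ne: "path_image g \<noteq> {}" by simp
    have gV: "path_image g \<subseteq> V" using g(2) sub by (auto simp: W_def)
    have "continuous_on (path_image g) (\<lambda>z. norm (f z))"
      using contf gV by (intro continuous_intros) (rule continuous_on_subset)
    then obtain p where p: "p \<in> path_image g" "\<And>w. w \<in> path_image g \<Longrightarrow> norm (f w) \<le> norm (f p)"
      using continuous_attains_sup[OF cp ne] by blast
    have IV: "I \<subseteq> V"
      using outside_subset_convex[OF V(2) gV] inside_Int_outside[of "path_image g"]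
      unfolding I_def by blast
    have bI: "bounded I" and oI: "open I"
      using cp by (auto simp: I_def bounded_inside compact_imp_bounded open_inside compact_imp_closed)
    have fr: "frontier I \<subseteq> path_image g"
      unfolding I_def using cp by (intro frontier_inside_subset compact_imp_closed)
    have clI: "closure I \<subseteq> V"
      using fr gV IV oI closure_Un_frontier[of I] by blast
    have le: "norm (f w) \<le> norm (f p)" if w: "w \<in> I" for w
    proof -
      \<comment> \<open>a linear functional that recovers the norm of f at w reduces to the scalar maximum principle\<close>
      define h where "h = (\<lambda>z. \<Sum>j\<in>UNIV. f z $ j * cnj (f w $ j))"
      have holh: "h holomorphic_on V" unfolding h_def by (intro holomorphic_intros hol)
      have "cmod (h w) \<le> norm (f p) * norm (f w)"
      proof (rule maximum_modulus_frontier[of h I])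
        show "h holomorphic_on interior I" using holh IV interior_subset holomorphic_on_subset by blast
        show "continuous_on (closure I) h"
          using holh clI holomorphic_on_imp_continuous_on holomorphic_on_subset by blast
        show "cmod (h z) \<le> norm (f p) * norm (f w)" if "z \<in> frontier I" for z
        proof -
          have "cmod (h z) \<le> norm (f z) * norm (f w)" unfolding h_def by (rule norm_sum_mult_cnj_le)
          also have "\<dots> \<le> norm (f p) * norm (f w)" using p(2) fr that by (intro mult_right_mono) auto
          finally show ?thesis .
        qed
      qed (use bI w in auto)
      moreover have "cmod (h w) = (norm (f w))\<^sup>2"
        unfolding h_def of_real_norm_vec_square[symmetric] by (simp add: norm_power)
      ultimately have "norm (f w) * norm (f w) \<le> norm (f p) * norm (f w)" by (simp add: power2_eq_square)
      then show ?thesis by (cases "norm (f w) = 0") auto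
    qed
    have "norm (f p) < s" using p(1) g(2) sub by (auto simp: W_def)
    with le IV have "I \<subseteq> W" by (force simp: W_def)
    have "connected (path_image g \<union> I)" unfolding I_def
      using cp g(1) by (intro connected_with_inside compact_imp_closed connected_path_image)
    moreover have "path_image g \<union> I \<subseteq> W" using \<open>I \<subseteq> W\<close> g(2) sub by blast
    moreover have "p \<in> path_image g \<union> I" using p by simp
    ultimately have "path_image g \<union> I \<subseteq> connected_component_set W p"
      by (intro connected_component_maximal)
    also have "\<dots> = \<Omega>" using p(1) g(2) unfolding \<Omega>_def
      by (metis connected_component_eq subsetD)
    finally have "z \<notin> inside (path_image g)" "z \<notin> path_image g" using g(4) by (auto simp: I_def)
    then have "z \<in> outside (path_image g)" using inside_Un_outside[of "path_image g"] by blast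
    then show ?thesis by (rule winding_number_zero_in_outside[OF g(1,3)])
  qed
  then have "simply_connected \<Omega>"
    using \<open>open \<Omega>\<close> by (auto simp: simply_connected_eq_winding_number_zero \<Omega>_def)
  then show "simply_connected (connected_component_set W a)" by (simp add: \<Omega>_def)
qed

text \<open>
  The ratio of the arithmetic to the geometric mean of \<open>1\<close> and \<open>a\<close> exceeds 1 by a definite factor on \<open>(0, r]\<close> and grows like
  \<open>a\<^sup>-\<^sup>1\<^sup>/\<^sup>2\<close> at \<open>0\<close>, so it absorbs a small power of \<open>a\<close> uniformly.
\<close>

lemma sqrt_AM_GM_gap:
  fixes r :: real
  assumes "0 < r" "r < 1"
  obtains \<kappa> where "\<kappa> > 0" "\<And>a. 0 < a \<Longrightarrow> a \<le> r \<Longrightarrow> (1 + a) / (2 * sqrt a) * a powr \<kappa> > 1"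
proof -
  define M where "M = 1 + (1 - sqrt r)\<^sup>2 / 2"
  have "M > 1" using assms by (simp add: M_def)
  \<comment> \<open>the exponent 1/4 serves for a up to 1/16, the factor M for the remaining a\<close>
  define \<kappa> where "\<kappa> = min (1/4) (ln M / (2 * ln 16))"
  have "\<kappa> > 0" using \<open>M > 1\<close> by (simp add: \<kappa>_def)
  moreover have "(1 + a) / (2 * sqrt a) * a powr \<kappa> > 1" if a: "0 < a" "a \<le> r" for a
  proof (cases "a \<le> 1 / 16")
    case True
    have "a powr \<kappa> \<ge> a powr (1/4)"
      using a assms by (intro powr_mono') (auto simp: \<kappa>_def)
    have "a powr (1/2) = a powr (1/4) * a powr (1/4)" by (simp flip: powr_add)
    moreover have "a powr (1/4) \<le> (1/16) powr (1/4)" using True a by (intro powr_mono2) auto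
    moreover have "(1/16 :: real) powr (1/4) = 1/2"
    proof -
      have "(1/16 :: real) = (1/2) powr 4" by (simp add: power_divide)
      then have "(1/16 :: real) powr (1/4) = (1/2) powr (4 * (1/4))" by (simp only: powr_powr)
      then show ?thesis by simp
    qed
    moreover have "a powr (1/4) > 0" using a by simp
    ultimately have "2 * sqrt a \<le> a powr (1/4)"
      using mult_left_mono[of "a powr (1/4)" "1/2" "a powr (1/4)"] a by (simp add: powr_half_sqrt)
    also have "\<dots> < (1 + a) * a powr (1/4)" using a by simp
    also have "\<dots> \<le> (1 + a) * a powr \<kappa>" using a \<open>a powr (1/4) \<le> a powr \<kappa>\<close> by simp
    finally show ?thesis using a by (simp add: field_simps)
  next
    case False
    have "sqrt a \<le> sqrt r" "sqrt a < 1" "sqrt r < 1" "0 < sqrt a" using a assms by auto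
    have "(1 - sqrt r)\<^sup>2 \<le> (1 - sqrt a)\<^sup>2"
      using \<open>sqrt a \<le> sqrt r\<close> \<open>sqrt r < 1\<close> by (intro power_mono) auto
    also have "\<dots> \<le> (1 - sqrt a)\<^sup>2 / sqrt a"
      using \<open>sqrt a < 1\<close> \<open>0 < sqrt a\<close> by (simp add: le_divide_eq mult_left_le)
    finally have "M \<le> 1 + (1 - sqrt a)\<^sup>2 / (2 * sqrt a)" by (simp add: M_def)
    also have "\<dots> = (1 + a) / (2 * sqrt a)"
      using \<open>0 < sqrt a\<close> a by (simp add: field_simps power2_eq_square)
    finally have 1: "M \<le> (1 + a) / (2 * sqrt a)" .
    have "ln M > 0" using \<open>M > 1\<close> by simp
    have "\<kappa> * ln 16 \<le> (ln M / (2 * ln 16)) * ln 16"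
      by (intro mult_right_mono) (auto simp: \<kappa>_def)
    also have "\<dots> < ln M" using \<open>ln M > 0\<close> by simp
    finally have "\<kappa> * ln 16 < ln M" .
    moreover have "- ln a < ln 16" using False a by (simp flip: ln_inverse add: field_simps)
    then have "\<kappa> * (- ln a) \<le> \<kappa> * ln 16" using \<open>\<kappa> > 0\<close> by (intro mult_left_mono) auto
    ultimately have "0 < ln M + \<kappa> * ln a" by simp
    then have "1 < exp (ln M + \<kappa> * ln a)" by simp
    also have "\<dots> = M * a powr \<kappa>" using \<open>M > 1\<close> a by (simp add: exp_add powr_def)
    also have "\<dots> \<le> (1 + a) / (2 * sqrt a) * a powr \<kappa>" using 1 by (intro mult_right_mono) auto
    finally show ?thesis .
  qed
  ultimately show thesis using that by blast
qed

text \<open>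
  Think of \<open>g\<close> as a peak function composed with \<open>f\<close>: its real part is not positive inside the ball of radius \<open>s\<close>, at most \<open>-c\<close>
  where \<open>f\<close> crosses the sphere, and tiny at the centre. Suppose \<open>f\<close> first leaves the ball at \<open>\<zeta>\<close> with \<open>|\<zeta>| = r0 \<le> r\<close>, and
  let \<open>q\<close> be a square root, on the component \<open>\<Omega>\<close>, of the Moebius map that vanishes at \<open>\<zeta>\<close>. After a further Moebius map moving \<open>q 0\<close> to
  \<open>0\<close> and division by the variable, the result \<open>H\<close> is at most \<open>1\<close> on the part of the boundary of \<open>\<Omega>\<close> in the unit circle and at most
  \<open>1 / r0\<close> on the exit part. The factor \<open>exp (K g)\<close> with \<open>K = - ln r0 / c\<close> makes it at most 1 there too. At the centre, however,
  \<open>|H|\<close> is \<open>(1 + r0) / (2 sqrt r0)\<close>, which by hypothesis \<open>gap\<close> is too large.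
\<close>

lemma disc_stays_near_peak_point:
  fixes f :: "complex \<Rightarrow> complex ^ 'k::finite" and g :: "complex \<Rightarrow> complex" and s c r \<kappa> :: real
  assumes holf: "\<And>j. (\<lambda>z. f z $ j) holomorphic_on ball 0 1"
    and holg: "g holomorphic_on ball 0 1"
    and neg: "\<And>z. z \<in> ball 0 1 \<Longrightarrow> norm (f z) \<le> s \<Longrightarrow> Re (g z) \<le> 0"
    and exit: "\<And>z. z \<in> ball 0 1 \<Longrightarrow> norm (f z) = s \<Longrightarrow> Re (g z) \<le> - c"
    and "c > 0" and start: "norm (f 0) < s"
    and r: "0 < r" "r < 1"
    and gap: "\<And>a. 0 < a \<Longrightarrow> a \<le> r \<Longrightarrow> (1 + a) / (2 * sqrt a) * a powr \<kappa> > 1"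
    and close: "- Re (g 0) \<le> \<kappa> * c"
    and z: "cmod z \<le> r"
  shows "norm (f z) < s"
proof (rule ccontr)
  assume "\<not> ?thesis"
  define W where "W = {z \<in> ball 0 1. norm (f z) < s}"
  have contf: "continuous_on (ball 0 1) f"
    using holf by (intro continuous_on_vec_lambda[where f="\<lambda>j z. f z $ j", simplified]) (simp add: holomorphic_on_imp_continuous_on)
  have contfn: "continuous_on (ball 0 1) (\<lambda>z. norm (f z))"
    by (intro continuous_intros contf)
  define E where "E = cball 0 r \<inter> (\<lambda>z. norm (f z)) -` {s..}"
  have sub: "cball 0 r \<subseteq> (ball 0 1 :: complex set)" using r by auto
  have "closed E" unfolding E_def
    using continuous_on_subset[OF contfn sub] by (intro continuous_closed_preimage) auto
  then have "compact E" unfolding compact_eq_bounded_closed E_def by (simp add: bounded_Int)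
  moreover have "z \<in> E" using \<open>\<not> norm (f z) < s\<close> z by (simp add: E_def)
  ultimately obtain \<zeta> where \<zeta>: "\<zeta> \<in> E" "\<And>w. w \<in> E \<Longrightarrow> cmod \<zeta> \<le> cmod w"
    using continuous_attains_inf[of E cmod] by (metis continuous_on_norm_id empty_iff)
  define r0 where "r0 = cmod \<zeta>"
  have "\<zeta> \<noteq> 0" using \<zeta>(1) start by (auto simp: E_def)
  then have r0: "0 < r0" "r0 \<le> r" using \<zeta>(1) by (auto simp: r0_def E_def)
  have ballW: "ball 0 r0 \<subseteq> W"
  proof
    fix w assume w: "w \<in> ball (0::complex) r0"
    then have "w \<notin> E" using \<zeta>(2)[of w] by (force simp: r0_def)
    with w r0 r show "w \<in> W" by (auto simp: E_def W_def)
  qed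
  define \<Omega> where "\<Omega> = connected_component_set W 0"
  have oW: "open W" and sc: "simply_connected \<Omega>"
    using simply_connected_sublevel_component(1)[OF holf open_ball convex_ball, of s]
      simply_connected_sublevel_component(2)[OF holf open_ball convex_ball, of s 0]
    unfolding W_def \<Omega>_def by auto
  have o\<Omega>: "open \<Omega>" unfolding \<Omega>_def using oW by (rule open_connected_component)
  have c\<Omega>: "connected \<Omega>" by (simp add: \<Omega>_def)
  have \<Omega>W: "\<Omega> \<subseteq> W" by (simp add: \<Omega>_def connected_component_subset)
  have \<Omega>1: "\<Omega> \<subseteq> ball 0 1" using \<Omega>W by (auto simp: W_def)
  have z0: "0 \<in> \<Omega>" using ballW r0 by (auto simp: \<Omega>_def)
  have \<zeta>1: "cmod \<zeta> < 1" using \<zeta>(1) r by (auto simp: E_def)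
  have \<zeta>\<Omega>: "\<zeta> \<notin> \<Omega>" using \<zeta>(1) \<Omega>W by (auto simp: E_def W_def)
  \<comment> \<open>the zero of this Moebius map is outside \<Omega>, so it has a square root there\<close>
  define b where "b = Moebius_function 0 \<zeta>"
  have holb: "b holomorphic_on \<Omega>"
    unfolding b_def using Moebius_function_holomorphic[OF \<zeta>1] \<Omega>1 by (rule holomorphic_on_subset)
  have b1: "cmod (b w) < 1" if "w \<in> \<Omega>" for w
    unfolding b_def using Moebius_function_norm_lt_1[OF \<zeta>1] that \<Omega>1 by auto
  have den: "1 - cnj v * w \<noteq> 0" if "cmod v < 1" "cmod w < 1" for v w
  proof -
    have "cmod (cnj v * w) < 1 * 1" using that mult_strict_mono'[of "cmod v" 1 "cmod w" 1] by (simp add: norm_mult)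
    then show ?thesis by auto
  qed
  have "b w \<noteq> 0" if "w \<in> \<Omega>" for w
  proof -
    have "w \<noteq> \<zeta>" "cmod w < 1" using that \<zeta>\<Omega> \<Omega>1 by auto
    then show ?thesis using den[OF \<zeta>1] by (simp add: b_def Moebius_function_simple)
  qed
  then obtain q where holq: "q holomorphic_on \<Omega>" and q: "\<And>w. w \<in> \<Omega> \<Longrightarrow> b w = (q w)\<^sup>2"
    using simply_connected_imp_holomorphic_sqrt[OF holb sc] o\<Omega>
    by (metis open_imp_locally_path_connected)
  have q1: "cmod (q w) < 1" if "w \<in> \<Omega>" for w
  proof -
    have "(cmod (q w))\<^sup>2 < 1" using b1[OF that] q[OF that] by (simp add: norm_power)
    then show ?thesis by (simp add: power2_less_1_iff abs_square_less_1)
  qed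
  define a where "a = q 0"
  have a1: "cmod a < 1" using q1 z0 by (simp add: a_def)
  have a2: "(cmod a)\<^sup>2 = r0"
  proof -
    have "(cmod a)\<^sup>2 = cmod (b 0)" using q[OF z0] by (simp add: a_def norm_power)
    then show ?thesis by (simp add: b_def Moebius_function_of_zero r0_def)
  qed
  have an0: "a \<noteq> 0" using a2 r0 by auto
  define F where "F = (\<lambda>w. (q w - a) / (1 - cnj a * q w))"
  have holF: "F holomorphic_on \<Omega>"
    unfolding F_def using den[OF a1 q1] by (intro holomorphic_intros holq) auto
  have F0: "F 0 = 0" by (simp add: F_def a_def)
  have F1: "cmod (F w) < 1" if "w \<in> \<Omega>" for w
    using Moebius_function_norm_lt_1[OF a1 q1[OF that], of 0] by (simp add: F_def Moebius_function_simple)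
  have dF: "cmod (deriv F 0) = (1 + r0) / (2 * sqrt r0)"
  proof -
    have dq: "(q has_field_derivative deriv q 0) (at 0)"
      using holq o\<Omega> z0 by (rule holomorphic_derivI)
    have "((\<lambda>w. (q w)\<^sup>2) has_field_derivative 2 * a * deriv q 0) (at 0)"
      by (auto intro!: derivative_eq_intros dq simp: a_def)
    then have "(b has_field_derivative 2 * a * deriv q 0) (at 0)"
      by (rule has_field_derivative_transform_within_open[OF _ o\<Omega> z0]) (simp add: q)
    moreover have "(b has_field_derivative 1 - \<zeta> * cnj \<zeta>) (at 0)"
      unfolding b_def Moebius_function_simple
      by (auto intro!: derivative_eq_intros)
    ultimately have "2 * a * deriv q 0 = 1 - \<zeta> * cnj \<zeta>" by (rule DERIV_unique)
    also have "\<dots> = of_real (1 - r0\<^sup>2)" unfolding of_real_diff r0_def complex_norm_square by simp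
    finally have "cmod (2 * a * deriv q 0) = \<bar>1 - r0\<^sup>2\<bar>" by (metis norm_of_real real_norm_def)
    then have dq': "2 * cmod a * cmod (deriv q 0) = 1 - r0\<^sup>2"
      using r0 r by (simp add: norm_mult power_le_one)
    have dn: "1 - cnj a * a \<noteq> 0" using den[OF a1 a1] .
    then have dn0: "1 - cnj a * q 0 \<noteq> 0" by (simp add: a_def)
    have "(F has_field_derivative
        ((deriv q 0 - 0) * (1 - cnj a * q 0) - (q 0 - a) * (0 - cnj a * deriv q 0))
        / ((1 - cnj a * q 0) * (1 - cnj a * q 0))) (at 0)"
      unfolding F_def by (intro DERIV_divide DERIV_diff DERIV_const DERIV_cmult dq dn0)
    then have "deriv F 0 = ((deriv q 0 - 0) * (1 - cnj a * q 0) - (q 0 - a) * (0 - cnj a * deriv q 0))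
        / ((1 - cnj a * q 0) * (1 - cnj a * q 0))" by (rule DERIV_imp_deriv)
    also have "\<dots> = deriv q 0 / (1 - cnj a * a)" using dn by (simp flip: a_def)
    also have "1 - cnj a * a = of_real (1 - r0)"
      using complex_norm_square[of a] by (simp add: a2 mult.commute)
    finally have "cmod (deriv F 0) = cmod (deriv q 0) / (1 - r0)"
      using r0 r by (simp add: norm_divide flip: of_real_diff)
    moreover have "sqrt r0 = cmod a" using a2 by (metis norm_ge_zero real_sqrt_unique)
    moreover have "1 - r0\<^sup>2 = (1 + r0) * (1 - r0)" by (simp add: power2_eq_square algebra_simps)
    ultimately have "cmod (deriv F 0) = cmod (deriv q 0) / (1 - r0)"
      "2 * sqrt r0 * cmod (deriv q 0) = (1 + r0) * (1 - r0)" using dq' by simp_all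
    then have "2 * sqrt r0 * cmod (deriv F 0) = 1 + r0" using r0 r by simp
    then show ?thesis using r0 by (simp add: eq_divide_eq mult_ac)
  qed
  define H where "H = (\<lambda>w. if w = 0 then deriv F 0 else F w / w)"
  have holH: "H holomorphic_on \<Omega>"
    using holF o\<Omega> by (rule pole_theorem_open_0[where a=0]) (auto simp: H_def F0)
  define K where "K = - ln r0 / c"
  have "ln r0 \<le> 0" using r0 r by simp
  then have "K \<ge> 0" using \<open>c > 0\<close> by (simp add: K_def divide_nonpos_pos)
  define G where "G = (\<lambda>w. H w * exp (of_real K * g w))"
  have holG: "G holomorphic_on \<Omega>"
    unfolding G_def using holg \<Omega>1 by (intro holomorphic_intros holH) (rule holomorphic_on_subset)
  have Gle: "cmod (G w) \<le> exp (K * Re (g w)) / cmod w" if "w \<in> \<Omega>" "w \<noteq> 0" for w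
  proof -
    have "cmod (G w) = cmod (F w) * exp (K * Re (g w)) / cmod w"
      using that by (simp add: G_def H_def norm_mult norm_divide)
    also have "\<dots> \<le> 1 * exp (K * Re (g w)) / cmod w"
      using F1[OF that(1)] by (intro divide_right_mono mult_right_mono) auto
    finally show ?thesis by simp
  qed
  have Gle1: "cmod (G w) \<le> 1 / cmod w" if "w \<in> \<Omega>" "w \<noteq> 0" for w
  proof -
    have "Re (g w) \<le> 0" using that \<Omega>W neg[of w] by (auto simp: W_def)
    then have "exp (K * Re (g w)) \<le> 1" using \<open>K \<ge> 0\<close> by (simp add: mult_nonneg_nonpos)
    then show ?thesis using Gle[OF that] by (meson divide_right_mono norm_ge_zero order_trans)
  qed
  have "cmod (G 0) \<le> 1"
  proof (rule maximum_modulus_limsup[OF holG o\<Omega> c\<Omega>])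
    show "bounded \<Omega>" using \<Omega>1 bounded_ball bounded_subset by blast
    fix p e assume p: "p \<in> frontier \<Omega>" and "(e :: real) > 0"
    have pcl: "p \<in> closure \<Omega>" and pn: "p \<notin> \<Omega>"
      using p o\<Omega> by (auto simp: frontier_def interior_open)
    have "p \<noteq> 0" using pn z0 by auto
    have "p islimpt \<Omega>" using pcl pn by (simp add: closure_def)
    then have nt: "at p within \<Omega> \<noteq> bot" by (simp add: trivial_limit_within)
    have "p \<in> cball 0 1" using pcl closure_mono[OF \<Omega>1] by (metis closure_ball subsetD zero_less_one)
    have ev: "\<forall>\<^sub>F w in at p within \<Omega>. w \<in> \<Omega> \<and> w \<noteq> 0"
      using z0 \<open>p \<noteq> 0\<close> by (auto simp: eventually_at intro!: exI[of _ "cmod p"] simp: dist_norm)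
    show "\<forall>\<^sub>F w in at p within \<Omega>. cmod (G w) < 1 + e"
    proof (cases "cmod p = 1")
      case True
      have "((\<lambda>w. 1 / cmod w) \<longlongrightarrow> 1 / cmod p) (at p within \<Omega>)"
        using \<open>p \<noteq> 0\<close> by (intro tendsto_intros) auto
      then have "\<forall>\<^sub>F w in at p within \<Omega>. 1 / cmod w < 1 + e"
        by (rule order_tendstoD) (use True \<open>e > 0\<close> in auto)
      with ev show ?thesis by eventually_elim (use Gle1 in force)
    next
      case False
      then have p1: "p \<in> ball 0 1" using \<open>p \<in> cball 0 1\<close> by simp
      have "p \<notin> W"
      proof
        \<comment> \<open>a component is relatively closed, so its boundary cannot meet W\<close>
        assume "p \<in> W"
        obtain T where T: "closed T" "\<Omega> = W \<inter> T"
          using closedin_connected_component[of W 0] unfolding \<Omega>_def[symmetric] closedin_closed by blast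
        then have "closure \<Omega> \<subseteq> T" by (simp add: closure_minimal)
        with pcl T \<open>p \<in> W\<close> pn show False by auto
      qed
      then have "norm (f p) \<ge> s" using p1 by (simp add: W_def)
      moreover have "norm (f p) \<le> s"
      proof (rule tendsto_upperbound[OF _ _ nt])
        have "continuous (at p) (\<lambda>z. norm (f z))"
          using contfn p1 by (simp add: continuous_on_eq_continuous_at)
        then show "((\<lambda>z. norm (f z)) \<longlongrightarrow> norm (f p)) (at p within \<Omega>)"
          using continuous_at_imp_continuous_at_within continuous_within by blast
        show "\<forall>\<^sub>F z in at p within \<Omega>. norm (f z) \<le> s"
          using ev by eventually_elim (use \<Omega>W in \<open>auto simp: W_def\<close>)
      qed
      ultimately have gp: "Re (g p) \<le> - c" using exit p1 by simp
      have "cmod p \<ge> r0" using \<open>p \<notin> W\<close> ballW by force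
      have "exp (K * Re (g p)) \<le> exp (K * (- c))" unfolding exp_le_cancel_iff by (rule mult_left_mono[OF gp \<open>K \<ge> 0\<close>])
      also have "K * (- c) = ln r0" using \<open>c > 0\<close> by (simp add: K_def)
      finally have "exp (K * Re (g p)) / cmod p \<le> 1"
        using \<open>cmod p \<ge> r0\<close> r0 \<open>p \<noteq> 0\<close> by simp
      have "continuous (at p) g"
        using holomorphic_on_imp_continuous_on[OF holg] p1
        by (simp add: continuous_on_eq_continuous_at del: mem_ball)
      then have "(g \<longlongrightarrow> g p) (at p within \<Omega>)"
        using continuous_at_imp_continuous_at_within continuous_within by blast
      then have "((\<lambda>w. exp (K * Re (g w)) / cmod w) \<longlongrightarrow> exp (K * Re (g p)) / cmod p) (at p within \<Omega>)"
        using \<open>p \<noteq> 0\<close> by (intro tendsto_intros) auto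
      then have "\<forall>\<^sub>F w in at p within \<Omega>. exp (K * Re (g w)) / cmod w < 1 + e"
        by (rule order_tendstoD) (use \<open>_ \<le> 1\<close> \<open>e > 0\<close> in auto)
      with ev show ?thesis by eventually_elim (use Gle in force)
    qed
  qed (rule z0)
  moreover have "cmod (G 0) = (1 + r0) / (2 * sqrt r0) * exp (K * Re (g 0))"
    by (simp add: G_def H_def norm_mult dF)
  moreover have "r0 powr \<kappa> \<le> exp (K * Re (g 0))"
  proof -
    have "ln r0 \<le> 0" using r0 r by simp
    have "- Re (g 0) / c \<le> \<kappa>" using close \<open>c > 0\<close> by (subst pos_divide_le_eq)
    then have "\<kappa> * ln r0 \<le> (- Re (g 0) / c) * ln r0" using \<open>ln r0 \<le> 0\<close> by (rule mult_right_mono_neg)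
    also have "\<dots> = K * Re (g 0)" by (simp add: K_def)
    finally show ?thesis using r0 by (simp add: powr_def)
  qed
  ultimately have le: "(1 + r0) / (2 * sqrt r0) * exp (K * Re (g 0)) \<le> 1"
      "r0 powr \<kappa> \<le> exp (K * Re (g 0))" by simp_all
  have "(1 + r0) / (2 * sqrt r0) * r0 powr \<kappa> \<le> (1 + r0) / (2 * sqrt r0) * exp (K * Re (g 0))"
    using r0 by (intro mult_left_mono le(2)) auto
  also note le(1)
  finally have "(1 + r0) / (2 * sqrt r0) * r0 powr \<kappa> \<le> 1" .
  with gap[OF r0] show False by simp
qed

section \<open>Exponentially flat profiles\<close>

text \<open>
  All that is used of an exponentially flat function: convexity to the right of \<open>0\<close>, the property \<open>contraction\<close> that distinguishes
  exponential flatness from finite order of vanishing, and decay faster than every power.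
\<close>

locale flat_profile =
  fixes \<phi> \<phi>' :: "real \<Rightarrow> real" and \<epsilon> :: real
  assumes \<epsilon>_pos: "\<epsilon> > 0"
    and zero: "\<phi> 0 = 0"
    and deriv_zero: "\<phi>' 0 = 0"
    and has_deriv: "\<And>x. (\<phi> has_real_derivative \<phi>' x) (at x)"
    and deriv_mono: "\<And>a b. 0 \<le> a \<Longrightarrow> a < b \<Longrightarrow> b < \<epsilon> \<Longrightarrow> \<phi>' a < \<phi>' b"
    and contraction: "\<And>l \<delta>. 0 < l \<Longrightarrow> l < 1 \<Longrightarrow> 0 < \<delta> \<Longrightarrow> \<forall>\<^sub>F y in at_right 0. \<phi> (l * y) \<le> \<delta> * \<phi> y"
    and power_decay: "\<And>p. 0 < p \<Longrightarrow> \<forall>\<^sub>F y in at_right 0. \<phi> y \<le> y powr p"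
begin

lemma deriv_pos: "0 < a \<Longrightarrow> a < \<epsilon> \<Longrightarrow> \<phi>' a > 0"
  using deriv_mono[of 0 a] deriv_zero by simp

lemma strict_mono: "\<phi> a < \<phi> b" if "0 \<le> a" "a < b" "b < \<epsilon>"
proof (rule DERIV_pos_imp_increasing_open[OF that(2)])
  show "\<exists>y. DERIV \<phi> x :> y \<and> y > 0" if "a < x" "x < b" for x
    using has_deriv deriv_pos that \<open>0 \<le> a\<close> \<open>b < \<epsilon>\<close> by (meson le_less_trans less_trans)
  show "continuous_on {a..b} \<phi>"
    using has_deriv by (meson DERIV_isCont continuous_at_imp_continuous_on)
qed

lemma mono: "\<phi> a \<le> \<phi> b" if "0 \<le> a" "a \<le> b" "b < \<epsilon>"
  using strict_mono[of a b] that by (cases "a = b") auto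

lemma pos: "0 < a \<Longrightarrow> a < \<epsilon> \<Longrightarrow> \<phi> a > 0"
  using strict_mono[of 0 a] zero by simp

lemma nonneg: "0 \<le> a \<Longrightarrow> a < \<epsilon> \<Longrightarrow> \<phi> a \<ge> 0"
  using mono[of 0 a] zero by simp

lemma isCont: "isCont \<phi> x"
  using has_deriv by (rule DERIV_isCont)

text \<open>
  Convexity: the graph lies above its tangent at \<open>y\<close>.
\<close>

lemma deriv_bound: "\<phi>' y * y \<le> \<phi> (2 * y)" if "0 \<le> y" "2 * y < \<epsilon>"
proof (cases "y = 0")
  case False
  then have "y < 2 * y" using that by simp
  then obtain u where u: "y < u" "u < 2 * y" "\<phi> (2 * y) - \<phi> y = (2 * y - y) * \<phi>' u"
    using MVT2[of y "2 * y" \<phi> \<phi>'] has_deriv by blast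
  have "\<phi>' y * y \<le> \<phi>' u * y"
    using deriv_mono[of y u] u that by (intro mult_right_mono) auto
  also have "\<dots> = \<phi> (2 * y) - \<phi> y" using u(3) by simp
  also have "\<dots> \<le> \<phi> (2 * y)" using nonneg[of y] that False by simp
  finally show ?thesis .
qed (use zero in simp)

end

text \<open>
  By hypothesis \<open>ln (\<phi> y) = - L y / y\<^sup>m\<close> with \<open>L y\<close> tending to a positive \<open>A = 1 / C\<close>. Replacing \<open>y\<close> by \<open>l y\<close> therefore lowers the
  logarithm by about \<open>A (l\<^sup>-\<^sup>m - 1) / y\<^sup>m\<close>, which tends to infinity; and \<open>1 / y\<^sup>m\<close> dominates \<open>- p ln y\<close>.
\<close>

lemma exponentially_flat_imp_flat_profile:
  assumes "exponentially_flat \<phi>"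
  obtains \<epsilon> where "flat_profile \<phi> (deriv \<phi>) \<epsilon>"
proof -
  have smooth: "((\<lambda>g s. vector_derivative g (at s)) ^^ k) \<phi> differentiable (at t)" for k t
    using assms by (auto simp: exponentially_flat_def smooth_on_def)
  have le0: "\<phi> x = 0" if "x \<le> 0" for x using assms that by (auto simp: exponentially_flat_def)
  obtain \<epsilon> where \<epsilon>: "\<epsilon> > 0" "\<And>x. 0 < x \<Longrightarrow> x < \<epsilon> \<Longrightarrow> deriv (deriv \<phi>) x > 0"
    using assms by (auto simp: exponentially_flat_def)
  obtain m C where m: "m > 0" and "C > 0"
    and lim: "((\<lambda>x. (- 1 / ln (\<phi> x)) / x powr m) \<longlongrightarrow> C) (at_right 0)"
    using assms by (auto simp: exponentially_flat_def)
  have d1: "(\<phi> has_real_derivative deriv \<phi> x) (at x)" for x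
    using smooth[of 0 x] by (simp add: DERIV_deriv_iff_real_differentiable)
  then have "vector_derivative \<phi> (at x) = deriv \<phi> x" for x
    by (simp add: has_real_derivative_iff_has_vector_derivative vector_derivative_at)
  then have d2: "(deriv \<phi> has_real_derivative deriv (deriv \<phi>) x) (at x)" for x
    using smooth[of 1 x] by (simp add: DERIV_deriv_iff_real_differentiable)
  have neg: "deriv \<phi> x = 0" if "x < 0" for x
  proof -
    have "((\<lambda>_. 0) has_real_derivative deriv \<phi> x) (at x)"
      by (rule has_field_derivative_transform_within_open[OF d1, of "{..<0}"]) (use that le0 in auto)
    then show ?thesis using DERIV_const DERIV_unique by blast
  qed
  have dz: "deriv \<phi> 0 = 0"
  proof (rule tendsto_unique[of "at_left (0::real)"])
    have "isCont (deriv \<phi>) 0" using d2 by (rule DERIV_isCont)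
    then show "(deriv \<phi> \<longlongrightarrow> deriv \<phi> 0) (at_left 0)"
      by (simp add: isCont_def filterlim_at_split)
    have "\<forall>\<^sub>F x in at_left 0. deriv \<phi> x = 0"
      using neg by (auto simp: eventually_at_filter)
    then show "(deriv \<phi> \<longlongrightarrow> 0) (at_left 0)" by (rule tendsto_eventually)
  qed simp
  have dmono: "deriv \<phi> a < deriv \<phi> b" if "0 \<le> a" "a < b" "b < \<epsilon>" for a b
  proof (rule DERIV_pos_imp_increasing_open[OF that(2)])
    show "\<exists>y. DERIV (deriv \<phi>) x :> y \<and> y > 0" if "a < x" "x < b" for x
      using d2 \<epsilon> that \<open>0 \<le> a\<close> \<open>b < \<epsilon>\<close> by (meson le_less_trans less_trans)
    show "continuous_on {a..b} (deriv \<phi>)"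
      using d2 by (meson DERIV_isCont continuous_at_imp_continuous_on)
  qed
  have pos: "\<phi> b > 0" if "0 < b" "b < \<epsilon>" for b
  proof -
    have "\<phi> 0 < \<phi> b"
    proof (rule DERIV_pos_imp_increasing_open[OF that(1)])
      show "\<exists>y. DERIV \<phi> x :> y \<and> y > 0" if "0 < x" "x < b" for x
        using d1 dmono[of 0 x] dz that \<open>b < \<epsilon>\<close> by (intro exI[of _ "deriv \<phi> x"]) auto
      show "continuous_on {0..b} \<phi>"
        using d1 by (meson DERIV_isCont continuous_at_imp_continuous_on)
    qed
    then show ?thesis using le0[of 0] by simp
  qed
  have evpos: "\<forall>\<^sub>F y in at_right 0. 0 < \<phi> y"
    using eventually_at_right_less[of 0] eventually_at_right_field[of "\<lambda>y. y < \<epsilon>" 0] \<epsilon>(1)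
    by (metis (mono_tags, lifting) eventually_at_right_field pos)
  define L where "L = (\<lambda>y. - ln (\<phi> y) * y powr m)"
  define A where "A = inverse C"
  have "A > 0" using \<open>C > 0\<close> by (simp add: A_def)
  have "((\<lambda>x. inverse ((- 1 / ln (\<phi> x)) / x powr m)) \<longlongrightarrow> A) (at_right 0)"
    unfolding A_def using lim \<open>C > 0\<close> by (intro tendsto_inverse) auto
  moreover have "inverse ((- 1 / ln (\<phi> x)) / x powr m) = L x" for x
    by (simp add: L_def field_simps)
  ultimately have L: "(L \<longlongrightarrow> A) (at_right 0)" by simp
  have lnphi: "ln (\<phi> y) = - L y / y powr m" if "y > 0" for y
    using that by (simp add: L_def)
  have big: "filterlim (\<lambda>y::real. 1 / y powr m) at_top (at_right 0)"
    using m by real_asymp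
  have contr: "\<forall>\<^sub>F y in at_right 0. \<phi> (l * y) \<le> \<delta> * \<phi> y" if "0 < l" "l < 1" "0 < \<delta>" for l \<delta>
  proof -
    have fl: "filterlim (\<lambda>y. l * y) (at_right 0) (at_right 0)"
      using that by real_asymp
    have L': "((\<lambda>y. L (l * y)) \<longlongrightarrow> A) (at_right 0)" by (rule filterlim_compose[OF L fl])
    have "l powr m < 1" using that m powr_less_mono2[of m l 1] by simp
    have "((\<lambda>y. L (l * y) / l powr m - L y) \<longlongrightarrow> A / l powr m - A) (at_right 0)"
      using that by (intro tendsto_intros L L') auto
    moreover have "A / l powr m - A > 0"
      using \<open>l powr m < 1\<close> that \<open>A > 0\<close> by (simp add: less_divide_eq)
    ultimately have "filterlim (\<lambda>y. (L (l * y) / l powr m - L y) * (1 / y powr m)) at_top (at_right 0)"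
      using big by (intro filterlim_tendsto_pos_mult_at_top)
    then have "\<forall>\<^sub>F y in at_right 0. (L (l * y) / l powr m - L y) * (1 / y powr m) \<ge> - ln \<delta>"
      by (simp add: filterlim_at_top)
    moreover have "\<forall>\<^sub>F y in at_right 0. 0 < \<phi> (l * y)"
      using evpos fl by (auto simp: filterlim_iff)
    moreover note evpos eventually_at_right_less[of 0]
    ultimately show ?thesis
    proof eventually_elim
      case (elim y)
      have "ln (\<phi> (l * y)) \<le> ln \<delta> + ln (\<phi> y)"
        using elim(1) that elim(4) by (simp add: lnphi powr_mult field_simps)
      also have "\<dots> = ln (\<delta> * \<phi> y)" using elim that by (simp add: ln_mult)
      finally show ?case using elim that by simp
    qed
  qed
  have decay: "\<forall>\<^sub>F y in at_right 0. \<phi> y \<le> y powr p" if "0 < p" for p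
  proof -
    have "((\<lambda>y::real. y powr m * ln y) \<longlongrightarrow> 0) (at_right 0)"
      using m by real_asymp
    from tendsto_add[OF L tendsto_mult_left[OF this, of p]]
    have "\<forall>\<^sub>F y in at_right 0. L y + p * (y powr m * ln y) > 0"
      using \<open>A > 0\<close> by (intro order_tendstoD(1)) auto
    with evpos eventually_at_right_less[of 0] show ?thesis
    proof eventually_elim
      case (elim y)
      have "ln (\<phi> y) \<le> p * ln y"
        using elim(2,3) by (simp add: lnphi field_simps)
      also have "\<dots> = ln (y powr p)" using elim by (simp add: ln_powr)
      finally show ?case using elim by (subst (asm) ln_le_cancel_iff) auto
    qed
  qed
  have "flat_profile \<phi> (deriv \<phi>) \<epsilon>"
    by unfold_locales (use \<epsilon> le0 dz d1 dmono contr decay in auto)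
  then show thesis using that by blast
qed

section \<open>Splitting off the first coordinate\<close>

text \<open>
  Near \<open>0\<close> the domain is the region below the graph of \<open>- \<phi>(|z'|\<^sup>2)\<close>, with \<open>ht\<close> as the height.
\<close>

abbreviation ht :: "complex ^ 'n::finite option \<Rightarrow> real" where "ht z \<equiv> Re (fst_coord z)"

lemma norm_square_split:
  fixes z :: "complex ^ ('n::finite option)"
  shows "(norm z)\<^sup>2 = (cmod (fst_coord z))\<^sup>2 + (norm (rest_coords z))\<^sup>2"
  by (simp add: norm_vec_def L2_set_def sum_nonneg fst_coord_def rest_coords_def UNIV_option_conv
    sum.reindex)

lemma norm_rest_coords_square: "(norm (rest_coords z))\<^sup>2 = (\<Sum>i\<in>UNIV. (cmod (rest_coords z $ i))\<^sup>2)"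
  by (simp add: norm_vec_def L2_set_def sum_nonneg)

lemma norm_fst_coord_le: "cmod (fst_coord z) \<le> norm z"
  by (rule power2_le_imp_le) (simp_all add: norm_square_split)

lemma norm_rest_coords_le: "norm (rest_coords z) \<le> norm z"
  by (rule power2_le_imp_le) (simp_all add: norm_square_split)

lemma norm_le_split: "norm z \<le> cmod (fst_coord z) + norm (rest_coords z)"
proof (rule power2_le_imp_le)
  show "(norm z)\<^sup>2 \<le> (cmod (fst_coord z) + norm (rest_coords z))\<^sup>2"
    unfolding norm_square_split power2_sum by simp
qed simp

lemma bounded_linear_fst_coord: "bounded_linear fst_coord"
  unfolding fst_coord_def by (rule bounded_linear_vec_nth)

lemma bounded_linear_rest_coords: "bounded_linear (rest_coords :: complex ^ ('n::finite option) \<Rightarrow> _)"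
proof (rule bounded_linear_intro[where K=1])
  show "norm (rest_coords z) \<le> norm z * 1" for z :: "complex ^ ('n option)"
    using norm_rest_coords_le[of z] by simp
qed (simp_all add: rest_coords_def vec_eq_iff)

lemmas coords_simps =
  linear_add[OF bounded_linear.linear[OF bounded_linear_fst_coord]]
  linear_add[OF bounded_linear.linear[OF bounded_linear_rest_coords]]
  linear_diff[OF bounded_linear.linear[OF bounded_linear_fst_coord]]
  linear_diff[OF bounded_linear.linear[OF bounded_linear_rest_coords]]
  linear_cmul[OF bounded_linear.linear[OF bounded_linear_fst_coord]]
  linear_cmul[OF bounded_linear.linear[OF bounded_linear_rest_coords]]
  linear_0[OF bounded_linear.linear[OF bounded_linear_fst_coord]]
  linear_0[OF bounded_linear.linear[OF bounded_linear_rest_coords]]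

definition join :: "complex \<Rightarrow> complex ^ 'n::finite \<Rightarrow> complex ^ ('n option)"
  where "join a w = (\<chi> j. case j of None \<Rightarrow> a | Some i \<Rightarrow> w $ i)"

lemma join_simps [simp]:
  "fst_coord (join a w) = a" "rest_coords (join a w) = w"
  by (simp_all add: join_def fst_coord_def rest_coords_def)

lemma join_fst_rest [simp]: "join (fst_coord z) (rest_coords z) = z"
  by (simp add: join_def fst_coord_def rest_coords_def vec_eq_iff split: option.splits)

lemma join_eqI: "fst_coord z = fst_coord w \<Longrightarrow> rest_coords z = rest_coords w \<Longrightarrow> z = w"
  by (metis join_fst_rest)

lemma continuous_on_coords [continuous_intros]:
  assumes "continuous_on S f"
  shows "continuous_on S (\<lambda>x. fst_coord (f x))" "continuous_on S (\<lambda>x. rest_coords (f x))"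
  using assms by (auto intro: bounded_linear.continuous_on bounded_linear_fst_coord bounded_linear_rest_coords)

text \<open>
  The real part of the Hermitian product is the Euclidean inner product; this passes from real to complex tangent vectors.
\<close>

lemma Re_sum_cnj_eq_inner:
  fixes u v :: "complex ^ 'n::finite"
  shows "Re (\<Sum>i\<in>UNIV. u $ i * cnj (v $ i)) = u \<bullet> v"
  by (simp add: inner_vec_def inner_complex_def)

section \<open>The boundary near a flat point\<close>

text \<open>
  The radius \<open>s\<close> is so small that \<open>|z'|\<^sup>2\<close> stays in the interval of convexity of \<open>\<phi>\<close> for \<open>|z| < 2 s\<close>. Outside this ball \<open>D\<close> is arbitrary.
\<close>

locale flat_boundary = flat_profile +
  fixes D :: "(complex ^ ('n::finite option)) set" and s :: real
  assumes s_pos: "s > 0" and s_small: "4 * s\<^sup>2 < \<epsilon>"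
    and open_D: "open D"
    and local_D: "\<And>z. norm z < 2 * s \<Longrightarrow> z \<in> D \<longleftrightarrow> ht z + \<phi> ((norm (rest_coords z))\<^sup>2) < 0"
begin

definition \<rho> :: "complex ^ ('n option) \<Rightarrow> real"
  where "\<rho> z = ht z + \<phi> ((norm (rest_coords z))\<^sup>2)"

lemma in_D_iff: "norm z < 2 * s \<Longrightarrow> z \<in> D \<longleftrightarrow> \<rho> z < 0"
  using local_D by (simp add: \<rho>_def)

lemma continuous_on_\<rho>: "continuous_on S \<rho>"
proof -
  have "continuous_on UNIV \<phi>" using isCont by (simp add: continuous_on_eq_continuous_at)
  then have "continuous_on S (\<lambda>z. \<phi> ((norm (rest_coords z))\<^sup>2))"
    by (rule continuous_on_compose2) (auto intro!: continuous_intros)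
  then show ?thesis unfolding \<rho>_def by (intro continuous_intros) auto
qed

lemma radius_bound: "norm z < 2 * s \<Longrightarrow> (norm (rest_coords z))\<^sup>2 < \<epsilon>"
proof -
  assume z: "norm z < 2 * s"
  have "(norm (rest_coords z))\<^sup>2 \<le> (2 * s)\<^sup>2"
    using z norm_rest_coords_le[of z] by (intro power_mono) auto
  then show ?thesis using s_small by (simp add: power_mult_distrib)
qed

lemma frontier_iff:
  assumes z: "norm z < 2 * s"
  shows "z \<in> frontier D \<longleftrightarrow> \<rho> z = 0"
proof
  have opB: "open (ball 0 (2 * s) :: (complex ^ ('n option)) set)" by simp
  assume fr: "z \<in> frontier D"
  have "\<not> \<rho> z < 0" using fr open_D in_D_iff[OF z] by (simp add: frontier_def interior_open)
  moreover have "\<not> \<rho> z > 0"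
  proof
    assume "\<rho> z > 0"
    define V where "V = {w \<in> ball 0 (2 * s). \<rho> w > 0}"
    have "V = ball 0 (2 * s) \<inter> \<rho> -` {0<..}" by (auto simp: V_def)
    then have "open V" using continuous_open_preimage[OF continuous_on_\<rho> opB open_greaterThan[of 0]] by simp
    moreover have "z \<in> V" using z \<open>\<rho> z > 0\<close> by (simp add: V_def)
    moreover have "z \<in> closure D" using fr by (simp add: frontier_def)
    ultimately have "V \<inter> D \<noteq> {}" by (metis open_Int_closure_eq_empty disjoint_iff)
    then show False using in_D_iff by (force simp: V_def)
  qed
  ultimately show "\<rho> z = 0" by simp
next
  assume 0: "\<rho> z = 0"
  then have "z \<notin> D" using in_D_iff[OF z] by simp
  moreover have "z \<in> closure D"
    unfolding closure_approachable
  proof (intro allI impI)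
    fix e :: real assume "e > 0"
    define h where "h = min (e / 2) ((2 * s - norm z) / 2)"
    have h: "h > 0" "h < e" "norm z + h < 2 * s" using \<open>e > 0\<close> z by (auto simp: h_def min_def field_simps)
    define w where "w = z - join (of_real h) 0"
    have nj: "norm (join (of_real h) (0 :: complex ^ 'n)) \<le> h"
      using norm_le_split[of "join (of_real h) (0 :: complex ^ 'n)"] h by simp
    then have "norm w < 2 * s" using h(3) norm_triangle_ineq4[of z "join (of_real h) 0"] unfolding w_def by linarith
    moreover have "\<rho> w < 0" using 0 h by (simp add: \<rho>_def w_def coords_simps)
    ultimately have "w \<in> D" using in_D_iff by simp
    moreover have "dist w z < e" using nj h by (simp add: w_def dist_norm)
    ultimately show "\<exists>y\<in>D. dist y z < e" by blast
  qed
  ultimately show "z \<in> frontier D" using open_D by (simp add: frontier_def interior_open)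
qed

lemma zero_in_frontier: "0 \<in> frontier D"
  using frontier_iff[of 0] s_pos zero by (simp add: \<rho>_def coords_simps)

lemma has_derivative_profile_along:
  assumes c: "(c has_vector_derivative v) (at (t::real))"
  shows "((\<lambda>u. \<phi> ((norm (rest_coords (c u)))\<^sup>2)) has_real_derivative
    2 * \<phi>' ((norm (rest_coords (c t)))\<^sup>2) * (rest_coords v \<bullet> rest_coords (c t))) (at t)"
proof -
  have "((\<lambda>u. rest_coords (c u)) has_vector_derivative rest_coords v) (at t)"
    using c by (rule bounded_linear.has_vector_derivative[OF bounded_linear_rest_coords])
  then have r: "((\<lambda>u. rest_coords (c u)) has_derivative (\<lambda>h. h *\<^sub>R rest_coords v)) (at t)"
    by (simp add: has_vector_derivative_def)
  have "((\<lambda>u. rest_coords (c u) \<bullet> rest_coords (c u)) has_derivative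
      (\<lambda>h. h * (2 * (rest_coords v \<bullet> rest_coords (c t))))) (at t)"
    using has_derivative_inner[OF r r] by (rule has_derivative_eq_rhs)
      (auto simp: inner_commute algebra_simps)
  then have "((\<lambda>u. (norm (rest_coords (c u)))\<^sup>2) has_real_derivative
      2 * (rest_coords v \<bullet> rest_coords (c t))) (at t)"
    unfolding power2_norm_eq_inner has_field_derivative_def by (rule has_derivative_eq_rhs) (simp add: fun_eq_iff)
  from DERIV_chain2[OF has_deriv this] show ?thesis by (simp add: mult_ac)
qed

text \<open>
  A curve in the boundary annihilates \<open>\<rho>\<close>, hence its velocity annihilates the differential of \<open>\<rho>\<close>. Conversely the line through \<open>p\<close> with such
  a velocity is brought back to the boundary by correcting the real part of the first coordinate, and the derivative of the correction vanishes at \<open>p\<close>.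
\<close>

lemma tangent_space_frontier:
  assumes p: "norm p < 2 * s" "p \<in> frontier D"
  shows "tangent_space (frontier D) p =
    {v. ht v + 2 * \<phi>' ((norm (rest_coords p))\<^sup>2) * (rest_coords v \<bullet> rest_coords p) = 0}"
proof (intro set_eqI iffI; clarsimp)
  fix v assume "v \<in> tangent_space (frontier D) p"
  then obtain c where c: "c 0 = p" "(c has_vector_derivative v) (at (0::real))"
    "\<forall>\<^sub>F u in at 0. c u \<in> frontier D" by (auto simp: tangent_space_def)
  have "isCont c 0" using c(2) by (rule has_vector_derivative_continuous)
  then have "((\<lambda>u. norm (c u)) \<longlongrightarrow> norm p) (at 0)" using c(1) by (auto simp: isCont_def intro!: tendsto_norm)
  then have "\<forall>\<^sub>F u in at 0. norm (c u) < 2 * s" using p(1) by (rule order_tendstoD)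
  with c(3) have "\<forall>\<^sub>F u in at 0. \<rho> (c u) = 0" by eventually_elim (use frontier_iff in blast)
  moreover have "\<rho> (c 0) = 0" using p frontier_iff c(1) by simp
  ultimately have ev: "\<forall>\<^sub>F u in nhds 0. \<rho> (c u) = 0"
    by (simp add: eventually_nhds_conv_at)
  have "((\<lambda>u. ht (c u)) has_real_derivative ht v) (at 0)"
    using bounded_linear.has_vector_derivative[OF bounded_linear_compose[OF bounded_linear_Re bounded_linear_fst_coord] c(2)]
    by (simp add: has_real_derivative_iff_has_vector_derivative)
  from DERIV_add[OF this has_derivative_profile_along[OF c(2)]]
  have d: "((\<lambda>u. \<rho> (c u)) has_real_derivative
      ht v + 2 * \<phi>' ((norm (rest_coords p))\<^sup>2) * (rest_coords v \<bullet> rest_coords p)) (at 0)"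
    by (simp add: \<rho>_def c(1))
  have "((\<lambda>u. 0) has_real_derivative
      ht v + 2 * \<phi>' ((norm (rest_coords p))\<^sup>2) * (rest_coords v \<bullet> rest_coords p)) (at 0)"
    using d ev by (subst (asm) DERIV_cong_ev[OF refl _ refl]) auto
  then show "ht v + 2 * \<phi>' ((norm (rest_coords p))\<^sup>2) * (rest_coords v \<bullet> rest_coords p) = 0"
    using DERIV_const DERIV_unique by blast
next
  fix v assume v: "ht v + 2 * \<phi>' ((norm (rest_coords p))\<^sup>2) * (rest_coords v \<bullet> rest_coords p) = 0"
  define l where "l = (\<lambda>u. p + u *\<^sub>R v)"
  have dl: "(l has_vector_derivative v) (at 0)"
    unfolding l_def by (auto intro!: derivative_eq_intros)
  define \<kappa> where "\<kappa> = (\<lambda>u. - \<rho> (l u))"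
  have "((\<lambda>u. ht (l u)) has_real_derivative ht v) (at 0)"
    using bounded_linear.has_vector_derivative[OF bounded_linear_compose[OF bounded_linear_Re bounded_linear_fst_coord] dl]
    by (simp add: has_real_derivative_iff_has_vector_derivative)
  from DERIV_minus[OF DERIV_add[OF this has_derivative_profile_along[OF dl]]]
  have "(\<kappa> has_real_derivative 0) (at 0)"
    using v by (simp add: \<rho>_def \<kappa>_def l_def)
  then have d\<kappa>: "((\<lambda>u. \<kappa> u *\<^sub>R (join 1 0 :: complex ^ ('n option))) has_vector_derivative 0) (at 0)"
    using bounded_linear.has_vector_derivative[OF bounded_linear_scaleR_left, of \<kappa> 0]
    by (simp add: has_real_derivative_iff_has_vector_derivative)
  define c where "c = (\<lambda>u. l u + \<kappa> u *\<^sub>R join 1 0)"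
  have dc: "(c has_vector_derivative v) (at 0)"
    using has_vector_derivative_add[OF dl d\<kappa>] by (simp add: c_def)
  have c0: "c 0 = p" using frontier_iff p by (simp add: c_def l_def \<kappa>_def)
  have "\<rho> (c u) = 0" for u by (simp add: c_def \<rho>_def \<kappa>_def coords_simps)
  moreover have "\<forall>\<^sub>F u in at 0. norm (c u) < 2 * s"
  proof -
    have "isCont c 0" using dc by (rule has_vector_derivative_continuous)
    then have "((\<lambda>u. norm (c u)) \<longlongrightarrow> norm p) (at 0)" using c0 by (auto simp: isCont_def intro!: tendsto_norm)
    then show ?thesis using p(1) by (rule order_tendstoD)
  qed
  ultimately have "\<forall>\<^sub>F u in at 0. c u \<in> frontier D"
    by (auto elim!: eventually_mono simp: frontier_iff)
  then show "v \<in> tangent_space (frontier D) p" using c0 dc by (auto simp: tangent_space_def)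
qed

lemma complex_tangent_space_frontier:
  assumes p: "norm p < 2 * s" "p \<in> frontier D"
  shows "v \<in> complex_tangent_space (frontier D) p \<longleftrightarrow>
    fst_coord v = - of_real (2 * \<phi>' ((norm (rest_coords p))\<^sup>2)) * (\<Sum>i\<in>UNIV. rest_coords v $ i * cnj (rest_coords p $ i))"
    (is "_ \<longleftrightarrow> _ = - of_real ?k * ?S")
proof -
  have "fst_coord (\<i> *s v) = \<i> * fst_coord v" by (simp add: fst_coord_def)
  moreover have "rest_coords (\<i> *s v) \<bullet> rest_coords p = Re (\<i> * ?S)"
    unfolding Re_sum_cnj_eq_inner[symmetric] by (simp add: rest_coords_def sum_distrib_left mult_ac)
  moreover have "rest_coords v \<bullet> rest_coords p = Re ?S"
    by (rule Re_sum_cnj_eq_inner[symmetric])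
  ultimately have "v \<in> complex_tangent_space (frontier D) p \<longleftrightarrow>
      Re (fst_coord v) + ?k * Re ?S = 0 \<and> - Im (fst_coord v) + ?k * (- Im ?S) = 0"
    by (simp add: complex_tangent_space_def tangent_space_frontier[OF p])
  also have "\<dots> \<longleftrightarrow> fst_coord v = - of_real ?k * ?S"
    by (auto simp: complex_eq_iff)
  finally show ?thesis .
qed

end

section \<open>The normal and the tangential distance\<close>

context flat_boundary begin

text \<open>
  The position of the points of a cone type stream: \<open>R\<close> is the radius at which the boundary has the same height as \<open>z\<close>, and both
  this height and \<open>|z'|\<close> are \<open>O(R\<^sup>2)\<close>, hence negligible against \<open>R\<close>. The estimates below hold for all
  admissible points with small \<open>\<eta>\<close>, so that no curve enters them.
\<close>

definition admissible :: "real \<Rightarrow> complex ^ ('n option) \<Rightarrow> real \<Rightarrow> bool"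
  where "admissible \<eta> z R \<longleftrightarrow> 0 < R \<and> R < \<eta> \<and> ht z = - \<phi> (R\<^sup>2) \<and> \<phi> (R\<^sup>2) \<le> R\<^sup>2 \<and>
    norm (rest_coords z) \<le> R\<^sup>2 \<and> norm z < \<eta>"

lemma eventually_at_right_0_obtain:
  assumes "\<forall>\<^sub>F y in at_right (0::real). P y"
  obtains \<eta> where "\<eta> > 0" "\<And>y. 0 < y \<Longrightarrow> y < \<eta> \<Longrightarrow> P y"
  using assms by (auto simp: eventually_at_right_field)

lemma contraction_radius:
  assumes "0 < l" "l < 1" "0 < \<delta>"
  obtains \<eta> where "\<eta> > 0" "\<And>R. 0 < R \<Longrightarrow> R < \<eta> \<Longrightarrow> \<phi> ((l * R)\<^sup>2) \<le> \<delta> * \<phi> (R\<^sup>2)"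
proof -
  have "0 < l\<^sup>2" "l\<^sup>2 < 1" using assms by (auto simp: power_less_one_iff)
  then obtain \<eta> where \<eta>: "\<eta> > 0" "\<And>y. 0 < y \<Longrightarrow> y < \<eta> \<Longrightarrow> \<phi> (l\<^sup>2 * y) \<le> \<delta> * \<phi> y"
    using eventually_at_right_0_obtain[OF contraction[of "l\<^sup>2" \<delta>]] assms(3) by blast
  show thesis
  proof (rule that[of "sqrt \<eta>"])
    show "sqrt \<eta> > 0" using \<eta>(1) by simp
    fix R assume R: "0 < R" "R < sqrt \<eta>"
    then have "R\<^sup>2 < (sqrt \<eta>)\<^sup>2" by (intro power_strict_mono) auto
    then have "R\<^sup>2 < \<eta>" using \<eta>(1) by simp
    then show "\<phi> ((l * R)\<^sup>2) \<le> \<delta> * \<phi> (R\<^sup>2)" using \<eta>(2)[of "R\<^sup>2"] R by (simp add: power_mult_distrib)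
  qed
qed

lemma closest_point_frontier:
  "closest_point (frontier D) z \<in> frontier D"
  "y \<in> frontier D \<Longrightarrow> dist z (closest_point (frontier D) z) \<le> dist z y"
  using closest_point_exists[of "frontier D" z] zero_in_frontier by auto

text \<open>
  Raising the first coordinate of \<open>z\<close> leads to a boundary point.
\<close>

lemma vertical_bound:
  assumes z: "z \<in> D" "norm z < s" and x: "- ht z < s"
  shows "normal_distance D z \<le> - ht z"
proof -
  define r where "r = norm (rest_coords z)"
  have r: "r\<^sup>2 < \<epsilon>" unfolding r_def using z(2) s_pos by (intro radius_bound) simp
  have neg: "ht z + \<phi> (r\<^sup>2) < 0" using z in_D_iff[of z] s_pos by (simp add: \<rho>_def r_def)
  have "\<phi> (r\<^sup>2) \<ge> 0" using nonneg r by simp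
  define h where "h = - ht z - \<phi> (r\<^sup>2)"
  have h: "0 < h" "h \<le> - ht z" using neg \<open>\<phi> (r\<^sup>2) \<ge> 0\<close> by (auto simp: h_def)
  define p where "p = z + join (of_real h) 0"
  have nj: "norm (join (of_real h) (0 :: complex ^ 'n)) \<le> h"
    using norm_le_split[of "join (of_real h) (0 :: complex ^ 'n)"] h by simp
  have "norm p < 2 * s" unfolding p_def
    using norm_triangle_ineq[of z "join (of_real h) 0"] nj h z(2) x by linarith
  moreover have "\<rho> p = 0" by (simp add: \<rho>_def p_def coords_simps h_def r_def)
  ultimately have "p \<in> frontier D" by (simp add: frontier_iff)
  then have "normal_distance D z \<le> dist z p" unfolding normal_distance_def by (rule closest_point_frontier)
  also have "\<dots> \<le> h" using nj by (simp add: p_def dist_norm)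
  finally show ?thesis using h by simp
qed

text \<open>
  The nearest boundary point lies in the known part of the boundary, over a radius that is \<open>O(R\<^sup>2)\<close> when \<open>z\<close> is admissible.
\<close>

lemma closest_point_localized:
  assumes z: "z \<in> D" "norm z < s / 2" and x: "- ht z < s / 2"
  defines "p \<equiv> closest_point (frontier D) z"
  shows "p \<in> frontier D" "norm p < 2 * s" "ht p = - \<phi> ((norm (rest_coords p))\<^sup>2)"
    "norm (rest_coords p) \<le> norm (rest_coords z) + (- ht z)"
proof -
  have le: "dist z p \<le> - ht z"
    unfolding p_def normal_distance_def[symmetric]
    using z x s_pos by (intro vertical_bound) auto
  show fr: "p \<in> frontier D" unfolding p_def by (rule closest_point_frontier)
  have "norm p \<le> norm z + dist z p" by (metis dist_norm norm_triangle_sub dist_commute)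
  then show n: "norm p < 2 * s" using le z x s_pos by linarith
  show "ht p = - \<phi> ((norm (rest_coords p))\<^sup>2)" using frontier_iff[OF n] fr by (simp add: \<rho>_def)
  have "norm (rest_coords p) \<le> norm (rest_coords z) + norm (rest_coords (p - z))"
    using norm_triangle_ineq[of "rest_coords z" "rest_coords (p - z)"] by (simp add: coords_simps)
  also have "norm (rest_coords (p - z)) \<le> dist z p"
    using norm_rest_coords_le[of "p - z"] by (simp add: dist_norm norm_minus_commute)
  finally show "norm (rest_coords p) \<le> norm (rest_coords z) + (- ht z)" using le by simp
qed

lemma admissible_in_D:
  obtains \<eta> where "\<eta> > 0" "\<And>z R. admissible \<eta> z R \<Longrightarrow> z \<in> D \<and> norm z < s / 2 \<and> - ht z < s / 2 \<and>
    R < 1/8 \<and> 4 * R\<^sup>2 < \<epsilon> \<and> R\<^sup>2 < \<epsilon> \<and> \<phi> (R\<^sup>2) > 0"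
proof -
  define \<eta> where "\<eta> = min (min (1/8) (s / 2)) (sqrt (\<epsilon> / 4))"
  have "\<eta> > 0" using s_pos \<epsilon>_pos by (simp add: \<eta>_def)
  moreover have "z \<in> D \<and> norm z < s / 2 \<and> - ht z < s / 2 \<and> R < 1/8 \<and> 4 * R\<^sup>2 < \<epsilon> \<and> R\<^sup>2 < \<epsilon> \<and> \<phi> (R\<^sup>2) > 0"
    if "admissible \<eta> z R" for z R
  proof -
    note a = that[unfolded admissible_def]
    have R: "0 < R" "R < 1/8" "R < s / 2" "R < sqrt (\<epsilon> / 4)" "norm z < s / 2"
      using a by (auto simp: \<eta>_def)
    then have "R\<^sup>2 < (sqrt (\<epsilon> / 4))\<^sup>2" by (intro power_strict_mono) auto
    then have R2: "4 * R\<^sup>2 < \<epsilon>" using \<epsilon>_pos by simp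
    have Re: "R\<^sup>2 < \<epsilon>" using R2 zero_le_power2[of R] by linarith
    have "R * R < R * 1" using R by (intro mult_strict_left_mono) auto
    then have RR: "R\<^sup>2 < R" by (simp add: power2_eq_square)
    have "(norm (rest_coords z))\<^sup>2 \<le> (R\<^sup>2)\<^sup>2" using a by (intro power_mono) auto
    also have "\<dots> < R\<^sup>2" using RR R by (simp add: power2_eq_square mult_strict_mono) 
    finally have "\<phi> ((norm (rest_coords z))\<^sup>2) < \<phi> (R\<^sup>2)"
      using Re by (intro strict_mono) auto
    then have "\<rho> z < 0" using a by (simp add: \<rho>_def)
    then have "z \<in> D" using in_D_iff R(5) s_pos by simp
    moreover have "\<phi> (R\<^sup>2) > 0" using R Re by (intro pos) auto
    ultimately show ?thesis using R R2 Re RR a by auto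
  qed
  ultimately show thesis using that by blast
qed

text \<open>
  The nearest boundary point \<open>p\<close> lies over a radius of at most \<open>R / 2\<close>, where by contraction the boundary is at most
  \<open>\<theta> \<phi>(R\<^sup>2)\<close> deep. So most of the height of \<open>z\<close> must be climbed to get from \<open>z\<close> to \<open>p\<close>.
\<close>

lemma normal_distance_asymp:
  assumes "0 < \<theta>" "\<theta> < 1"
  obtains \<eta> where "\<eta> > 0" "\<And>z R. admissible \<eta> z R \<Longrightarrow>
    (1 - \<theta>) * \<phi> (R\<^sup>2) \<le> normal_distance D z \<and> normal_distance D z \<le> \<phi> (R\<^sup>2)"
proof -
  obtain \<eta>1 where \<eta>1: "\<eta>1 > 0" "\<And>z R. admissible \<eta>1 z R \<Longrightarrow> z \<in> D \<and> norm z < s / 2 \<and> - ht z < s / 2 \<and>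
    R < 1/8 \<and> 4 * R\<^sup>2 < \<epsilon> \<and> R\<^sup>2 < \<epsilon> \<and> \<phi> (R\<^sup>2) > 0" by (rule admissible_in_D) (rule that)
  obtain \<eta>2 where \<eta>2: "\<eta>2 > 0" "\<And>R. 0 < R \<Longrightarrow> R < \<eta>2 \<Longrightarrow> \<phi> ((1/2 * R)\<^sup>2) \<le> \<theta> * \<phi> (R\<^sup>2)"
    by (rule contraction_radius[of "1/2" \<theta>]) (use assms in auto)
  have "(1 - \<theta>) * \<phi> (R\<^sup>2) \<le> normal_distance D z \<and> normal_distance D z \<le> \<phi> (R\<^sup>2)"
    if "admissible (min \<eta>1 \<eta>2) z R" for z R
  proof -
    have a: "0 < R" "R < \<eta>2" "ht z = - \<phi> (R\<^sup>2)" "\<phi> (R\<^sup>2) \<le> R\<^sup>2" "norm (rest_coords z) \<le> R\<^sup>2"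
      and "admissible \<eta>1 z R" using that by (auto simp: admissible_def)
    note b = \<eta>1(2)[OF this(6)]
    define p where "p = closest_point (frontier D) z"
    note p = closest_point_localized[of z, folded p_def]
    have p3: "ht p = - \<phi> ((norm (rest_coords p))\<^sup>2)" using p b by blast
    have "norm (rest_coords p) \<le> 2 * R\<^sup>2" using p(4) b a by linarith
    also have "2 * R\<^sup>2 \<le> 1/2 * R" using a b by (simp add: power2_eq_square)
    finally have "(norm (rest_coords p))\<^sup>2 \<le> (1/2 * R)\<^sup>2" by (rule power_mono) simp
    then have "\<phi> ((norm (rest_coords p))\<^sup>2) \<le> \<phi> ((1/2 * R)\<^sup>2)"
    proof (intro mono)
      have "(1/2 * R)\<^sup>2 \<le> R\<^sup>2" by (simp add: power_divide)
      then show "(1/2 * R)\<^sup>2 < \<epsilon>" using b by linarith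
    qed auto
    also have "\<dots> \<le> \<theta> * \<phi> (R\<^sup>2)" using \<eta>2 a by blast
    finally have "(1 - \<theta>) * \<phi> (R\<^sup>2) \<le> ht p - ht z" using p3 a by (simp add: algebra_simps)
    also have "\<dots> = Re (fst_coord (p - z))" by (simp add: coords_simps)
    also have "\<dots> \<le> norm (p - z)" using complex_Re_le_cmod norm_fst_coord_le order_trans by blast
    finally have 1: "(1 - \<theta>) * \<phi> (R\<^sup>2) \<le> normal_distance D z"
      by (simp add: normal_distance_def p_def dist_norm norm_minus_commute)
    have "normal_distance D z \<le> - ht z" using b s_pos by (intro vertical_bound) auto
    then show ?thesis using 1 a by simp
  qed
  then show thesis using that[of "min \<eta>1 \<eta>2"] \<eta>1(1) \<eta>2(1) by simp
qed

text \<open>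
  In the complex tangent hyperplane at the nearest boundary point the first coordinate varies by at most \<open>x / 2\<close> over the relevant range, where
  \<open>x = \<phi>(R\<^sup>2)\<close> (facts \<open>tilt\<close> and \<open>tilt'\<close>). By contraction the depths between \<open>x / 2\<close> and \<open>2 x\<close> occur
  on the boundary only at radii between \<open>(1 - \<theta>/2) R\<close> and \<open>(1 + \<theta>/4) R\<close>, and \<open>z'\<close> is negligible.
\<close>

lemma tangential_distance_asymp:
  assumes \<theta>: "0 < \<theta>" "\<theta> < 1"
  obtains \<eta> where "\<eta> > 0" "\<And>z R. admissible \<eta> z R \<Longrightarrow>
    (1 - \<theta>) * R \<le> tangential_distance D z \<and> tangential_distance D z \<le> (1 + \<theta>) * R"
proof -
  obtain \<eta>1 where \<eta>1: "\<eta>1 > 0" "\<And>z R. admissible \<eta>1 z R \<Longrightarrow> z \<in> D \<and> norm z < s / 2 \<and> - ht z < s / 2 \<and>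
    R < 1/8 \<and> 4 * R\<^sup>2 < \<epsilon> \<and> R\<^sup>2 < \<epsilon> \<and> \<phi> (R\<^sup>2) > 0" by (rule admissible_in_D) (rule that)
  obtain \<eta>2 where \<eta>2: "\<eta>2 > 0" "\<And>R. 0 < R \<Longrightarrow> R < \<eta>2 \<Longrightarrow> \<phi> ((1/2 * R)\<^sup>2) \<le> 1/64 * \<phi> (R\<^sup>2)"
    by (rule contraction_radius[of "1/2" "1/64"]) auto
  obtain \<eta>3 where \<eta>3: "\<eta>3 > 0" "\<And>R. 0 < R \<Longrightarrow> R < \<eta>3 \<Longrightarrow> \<phi> (((1 - \<theta>/2) * R)\<^sup>2) \<le> 1/4 * \<phi> (R\<^sup>2)"
  proof -
    have "0 < 1 - \<theta>/2" "1 - \<theta>/2 < 1" "(0::real) < 1/4" using \<theta> by auto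
    then show thesis by (rule contraction_radius) (rule that)
  qed
  obtain \<eta>4 where \<eta>4: "\<eta>4 > 0" "\<And>R. 0 < R \<Longrightarrow> R < \<eta>4 \<Longrightarrow> \<phi> ((1 / (1 + \<theta>/4) * R)\<^sup>2) \<le> 1/4 * \<phi> (R\<^sup>2)"
  proof -
    have "0 < 1 / (1 + \<theta>/4)" "1 / (1 + \<theta>/4) < 1" "(0::real) < 1/4" using \<theta> by auto
    then show thesis by (rule contraction_radius) (rule that)
  qed
  define \<eta> where "\<eta> = Min {\<eta>1, \<eta>2, \<eta>3, \<eta>4 / 2, \<theta> / 4, s / 8}"
  have "\<eta> > 0" using \<eta>1(1) \<eta>2(1) \<eta>3(1) \<eta>4(1) \<theta> s_pos by (simp add: \<eta>_def)
  moreover have "(1 - \<theta>) * R \<le> tangential_distance D z \<and> tangential_distance D z \<le> (1 + \<theta>) * R"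
    if adm: "admissible \<eta> z R" for z R
  proof -
    have le: "\<eta> \<le> \<eta>1" "\<eta> \<le> \<eta>2" "\<eta> \<le> \<eta>3" "\<eta> \<le> \<eta>4 / 2" "\<eta> \<le> \<theta> / 4" "\<eta> \<le> s / 8"
      unfolding \<eta>_def by (rule Min_le; simp)+
    have a: "0 < R" "R < \<eta>2" "R < \<eta>3" "R < \<eta>4 / 2" "R < \<theta> / 4" "R < s / 8"
        "ht z = - \<phi> (R\<^sup>2)" "\<phi> (R\<^sup>2) \<le> R\<^sup>2" "norm (rest_coords z) \<le> R\<^sup>2"
      using adm le unfolding admissible_def by linarith+
    have "admissible \<eta>1 z R" using adm le(1) unfolding admissible_def by linarith
    note b = \<eta>1(2)[OF this]
    define x where "x = \<phi> (R\<^sup>2)"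
    have x: "0 < x" "ht z = - x" "x \<le> R\<^sup>2" using a b by (auto simp: x_def)
    have RR: "R\<^sup>2 \<le> \<theta> / 4 * R" using a by (simp add: power2_eq_square)
    define p where "p = closest_point (frontier D) z"
    have p: "p \<in> frontier D" "norm p < 2 * s" "ht p = - \<phi> ((norm (rest_coords p))\<^sup>2)"
        "norm (rest_coords p) \<le> norm (rest_coords z) + (- ht z)"
      using closest_point_localized[of z, folded p_def] b by blast+
    define T where "T = complex_tangent_space (frontier D) p"
    define k where "k = 2 * \<phi>' ((norm (rest_coords p))\<^sup>2)"
    have T: "v \<in> T \<longleftrightarrow> fst_coord v = - of_real k * (\<Sum>i\<in>UNIV. rest_coords v $ i * cnj (rest_coords p $ i))" for v
      unfolding T_def k_def by (rule complex_tangent_space_frontier[OF p(2,1)])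
    define P where "P = norm (rest_coords p)"
    have P: "0 \<le> P" "P \<le> 2 * R\<^sup>2" using p(4) a by (auto simp: P_def)
    have R2: "0 < R\<^sup>2" "R\<^sup>2 < \<epsilon>" using a(1) b by auto
    have "2 * R\<^sup>2 \<le> R / 4" using a(1) b by (simp add: power2_eq_square)
    with P have "P\<^sup>2 \<le> (R / 4)\<^sup>2" by (intro power_mono) auto
    then have P2: "P\<^sup>2 \<le> R\<^sup>2 / 16" by (simp add: power_divide)
    \<comment> \<open>the slope of the boundary at p, from convexity between the radius P and the much larger R / 2\<close>
    have "\<phi>' (P\<^sup>2) \<le> \<phi>' (R\<^sup>2 / 8)"
    proof (rule less_imp_le, rule deriv_mono)
      show "P\<^sup>2 < R\<^sup>2 / 8" using P2 R2 by linarith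
      show "R\<^sup>2 / 8 < \<epsilon>" using R2 by linarith
    qed simp
    then have "\<phi>' (P\<^sup>2) * (R\<^sup>2 / 8) \<le> \<phi>' (R\<^sup>2 / 8) * (R\<^sup>2 / 8)" by (intro mult_right_mono) auto
    also have "\<dots> \<le> \<phi> (2 * (R\<^sup>2 / 8))" using R2 by (intro deriv_bound; linarith)
    also have "2 * (R\<^sup>2 / 8) = (1/2 * R)\<^sup>2" by (simp add: power_divide power_mult_distrib)
    also have "\<phi> \<dots> \<le> 1/64 * x" using \<eta>2(2) a by (simp add: x_def)
    finally have tilt: "\<phi>' (P\<^sup>2) * R\<^sup>2 \<le> x / 8" by (simp add: mult_ac)
    have k0: "k \<ge> 0"
    proof -
      have "\<phi>' (P\<^sup>2) \<ge> 0"
      proof (cases "P = 0")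
        case False
        then show ?thesis using P P2 R2 by (intro less_imp_le deriv_pos) (simp, linarith)
      qed (use deriv_zero in simp)
      then show ?thesis by (simp add: k_def P_def)
    qed
    have tilt': "cmod (fst_coord v) \<le> x / 2 * norm (rest_coords v)" if "v \<in> T" for v
    proof -
      have "cmod (fst_coord v) \<le> k * (norm (rest_coords v) * P)"
        using that k0 norm_sum_mult_cnj_le[of "rest_coords v" "rest_coords p"]
        by (simp add: T norm_mult P_def mult_left_mono)
      also have "\<dots> \<le> k * (norm (rest_coords v) * (2 * R\<^sup>2))"
        using P k0 by (intro mult_left_mono) auto
      also have "\<dots> = 4 * (\<phi>' (P\<^sup>2) * R\<^sup>2) * norm (rest_coords v)" by (simp add: k_def P_def)
      also have "\<dots> \<le> 4 * (x / 8) * norm (rest_coords v)"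
        using tilt by (intro mult_right_mono) auto
      finally show ?thesis by simp
    qed
    have scale: "c *\<^sub>R v \<in> T" if "v \<in> T" for c v
      using that by (simp add: T coords_simps) (simp add: scaleR_conv_of_real sum_distrib_left mult_ac vector_scaleR_component)
    define S where "S = frontier D \<inter> {z + v |v. v \<in> T}"
    have td: "tangential_distance D z = infdist z S"
      by (simp add: tangential_distance_def S_def T_def p_def)
    have lower: "(1 - \<theta>) * R \<le> dist z w" if w: "w \<in> S" for w
    proof (rule ccontr)
      assume "\<not> ?thesis"
      then have lt: "dist z w < (1 - \<theta>) * R" by simp
      obtain v where v: "v \<in> T" "w = z + v" using w by (auto simp: S_def)
      have nv: "norm v < (1 - \<theta>) * R" using lt v(2) by (simp add: dist_norm)
      also have "\<dots> \<le> R" using a \<theta> by (simp add: mult_le_cancel_right1)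
      finally have "norm v < R" .
      have "norm w < 2 * s" using v(2) norm_triangle_ineq[of z v] \<open>norm v < R\<close> a b by simp
      then have "\<rho> w = 0" using w frontier_iff by (simp add: S_def)
      then have eq: "\<phi> ((norm (rest_coords w))\<^sup>2) = x - ht v" using v x by (simp add: \<rho>_def coords_simps)
      have nr: "norm (rest_coords v) \<le> norm v" by (rule norm_rest_coords_le)
      have "\<bar>ht v\<bar> \<le> x / 2 * norm (rest_coords v)" using tilt'[OF v(1)] abs_Re_le_cmod order_trans by blast
      also have "\<dots> \<le> x / 2 * 1" using nr \<open>norm v < R\<close> b x by (intro mult_left_mono) auto
      finally have ge: "\<phi> ((norm (rest_coords w))\<^sup>2) \<ge> x / 2" using eq by linarith
      have "norm (rest_coords w) \<le> norm (rest_coords z) + norm (rest_coords v)"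
        using v(2) by (simp add: coords_simps norm_triangle_ineq)
      also have "\<dots> \<le> \<theta> / 4 * R + (1 - \<theta>) * R" using a(9) RR nr nv by linarith
      also have "\<dots> \<le> (1 - \<theta>/2) * R" using a \<theta> by (simp add: algebra_simps)
      finally have "(norm (rest_coords w))\<^sup>2 \<le> ((1 - \<theta>/2) * R)\<^sup>2" by (rule power_mono) simp
      moreover have "((1 - \<theta>/2) * R)\<^sup>2 < \<epsilon>"
      proof -
        have "((1 - \<theta>/2) * R)\<^sup>2 \<le> (1 * R)\<^sup>2" using \<theta> a by (intro power_mono mult_right_mono) auto
        then show ?thesis using b by simp
      qed
      ultimately have "\<phi> ((norm (rest_coords w))\<^sup>2) \<le> \<phi> (((1 - \<theta>/2) * R)\<^sup>2)" by (intro mono) auto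
      also have "\<dots> \<le> 1/4 * x" using \<eta>3(2) a by (simp add: x_def)
      finally show False using ge x by simp
    qed
    \<comment> \<open>moving from z in a fixed tangential direction by slightly more than R leaves D\<close>
    obtain i0 :: 'n where True by simp
    define L where "L = (1 + \<theta>/2) * R"
    have L: "0 < L" "L \<le> 2 * R" "L < 1" proof -
      show "0 < L" using \<theta> a(1) by (simp add: L_def)
      show "L \<le> 2 * R" using \<theta> a(1) unfolding L_def by (intro mult_right_mono) auto
      then show "L < 1" using b by linarith
    qed
    define e where "e = (of_real L *s axis i0 1 :: complex ^ 'n)"
    have ne: "norm e = L" using L by (simp add: e_def norm_vector_scalar_mult)
    define v where "v = join (- of_real k * (\<Sum>i\<in>UNIV. e $ i * cnj (rest_coords p $ i))) e"
    have vT: "v \<in> T" by (simp add: T v_def)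
    have v1: "cmod (fst_coord v) \<le> x / 2 * L" using tilt'[OF vT] by (simp add: v_def ne)
    have "x / 2 * L \<le> x / 2 * 1" using x L by (intro mult_left_mono) auto
    then have v1': "cmod (fst_coord v) \<le> x / 2" using v1 by linarith
    have nv: "norm v \<le> (1 + \<theta>) * R"
    proof -
      have "norm v \<le> x / 2 + L" using norm_le_split[of v] v1' by (simp add: v_def ne)
      also have "\<dots> \<le> \<theta> / 4 * R + (1 + \<theta>/2) * R" using x RR by (simp add: L_def)
      also have "\<dots> \<le> (1 + \<theta>) * R" using a \<theta> by (simp add: algebra_simps)
      finally show ?thesis .
    qed
    also have "\<dots> \<le> 2 * R" using \<theta> a by (intro mult_right_mono) auto
    finally have nv2: "norm v \<le> 2 * R" .
    define w where "w = z + v"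
    have "norm w < 2 * s" using norm_triangle_ineq[of z v] nv2 a b by (simp add: w_def)
    moreover have "\<rho> w > 0"
    proof -
      have "L \<le> norm (rest_coords w) + norm (rest_coords z)"
        using norm_triangle_ineq4[of "rest_coords w" "rest_coords z"] by (simp add: w_def coords_simps v_def ne)
      then have "(1 + \<theta>/2) * R - \<theta> / 4 * R \<le> norm (rest_coords w)" using a(9) RR by (simp add: L_def)
      then have ge: "(1 + \<theta>/4) * R \<le> norm (rest_coords w)" by (simp add: algebra_simps)
      define Q where "Q = (1 + \<theta>/4) * R"
      have "Q \<le> 2 * R" using \<theta> a(1) unfolding Q_def by (intro mult_right_mono) auto
      then have Q: "Q < \<eta>4" using a(4) by linarith
      have "0 < Q" using a(1) \<theta> by (simp add: Q_def)
      note Q = this Q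
      have "Q\<^sup>2 \<le> (norm (rest_coords w))\<^sup>2" using ge Q by (intro power_mono) (auto simp: Q_def)
      then have "\<phi> (Q\<^sup>2) \<le> \<phi> ((norm (rest_coords w))\<^sup>2)"
        using radius_bound[OF \<open>norm w < 2 * s\<close>] by (intro mono) auto
      moreover have "x \<le> 1/4 * \<phi> (Q\<^sup>2)"
      proof -
        have "1 / (1 + \<theta>/4) * Q = R" using \<theta> by (simp add: Q_def)
        then show ?thesis using \<eta>4(2)[OF Q] by (simp add: x_def)
      qed
      moreover have "\<bar>ht v\<bar> \<le> x / 2" using v1' abs_Re_le_cmod order_trans by blast
      ultimately show ?thesis using x by (simp add: \<rho>_def w_def coords_simps)
    qed
    ultimately have "w \<notin> D" using in_D_iff by fastforce
    have "closed_segment z w \<inter> frontier D \<noteq> {}"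
      using \<open>w \<notin> D\<close> b by (intro connected_Int_frontier) auto
    then obtain q where q: "q \<in> closed_segment z w" "q \<in> frontier D" by blast
    then obtain u where u: "0 \<le> u" "u \<le> 1" "q = (1 - u) *\<^sub>R z + u *\<^sub>R w" by (auto simp: closed_segment_def)
    have q': "q = z + u *\<^sub>R v" using u(3) by (simp add: w_def algebra_simps)
    have "q \<in> S" unfolding S_def using q(2) q' scale[OF vT] by blast
    have "dist z q = u * norm v" unfolding q' using u(1) by (simp add: dist_norm)
    also have "\<dots> \<le> norm v" using u by (simp add: mult_left_le_one_le)
    finally have "dist z q \<le> (1 + \<theta>) * R" using nv by simp
    then have "tangential_distance D z \<le> (1 + \<theta>) * R"
      using infdist_le[OF \<open>q \<in> S\<close>, of z] td by simp
    moreover have "(1 - \<theta>) * R \<le> tangential_distance D z"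
    proof -
      have "S \<noteq> {}" using \<open>q \<in> S\<close> by blast
      then show ?thesis unfolding td infdist_notempty[OF \<open>S \<noteq> {}\<close>] by (intro cINF_greatest lower)
    qed
    ultimately show ?thesis by simp
  qed
  ultimately show thesis using that by blast
qed

end

section \<open>Maps of the ball and localization\<close>

lemma holomorphic_map_slice:
  fixes \<psi> :: "complex ^ 'k::finite \<Rightarrow> complex ^ 'm::finite"
  assumes hol: "holomorphic_map_on (ball 0 1) \<psi>" and u: "norm u \<le> 1"
  shows "(\<lambda>\<zeta>. \<psi> (\<zeta> *s u) $ j) holomorphic_on ball 0 1"
    and "deriv (\<lambda>\<zeta>. \<psi> (\<zeta> *s u) $ j) 0 = (jacobian \<psi> (at 0) *v u) $ j"
proof -
  have bl: "bounded_linear (\<lambda>\<zeta>. \<zeta> *s u)"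
  proof (rule bounded_linear_intro[where K="norm u"])
    show "norm (\<zeta> *s u) \<le> norm \<zeta> * norm u" for \<zeta> by (simp add: norm_vector_scalar_mult)
  qed (simp_all add: vec_eq_iff algebra_simps scaleR_conv_of_real[where 'a=complex])
  have main: "((\<lambda>\<zeta>. \<psi> (\<zeta> *s u) $ j) has_field_derivative f' u $ j) (at \<zeta>)"
    if f': "(\<psi> has_derivative f') (at (\<zeta> *s u))" "Vector_Spaces.linear (*s) (*s) f'" for \<zeta> f'
  proof -
    have "((\<lambda>\<zeta>. \<psi> (\<zeta> *s u)) has_derivative (\<lambda>h. f' (h *s u))) (at \<zeta>)"
      using has_derivative_compose[OF bounded_linear_imp_has_derivative[OF bl] f'(1)] .
    then have "((\<lambda>\<zeta>. \<psi> (\<zeta> *s u) $ j) has_derivative (\<lambda>h. f' (h *s u) $ j)) (at \<zeta>)"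
      by (rule bounded_linear.has_derivative[OF bounded_linear_vec_nth])
    moreover have "f' (h *s u) $ j = f' u $ j * h" for h
    proof -
      have "f' (h *s u) = h *s f' u" by (metis matrix_works[OF f'(2)] vec.scale)
      then show ?thesis by (simp add: mult.commute)
    qed
    ultimately show ?thesis by (simp add: has_field_derivative_def)
  qed
  show "(\<lambda>\<zeta>. \<psi> (\<zeta> *s u) $ j) holomorphic_on ball 0 1"
  proof (subst holomorphic_on_open; clarsimp)
    fix \<zeta> :: complex assume "cmod \<zeta> < 1"
    then have "norm (\<zeta> *s u) < 1"
      using u mult_left_le[of "norm u" "cmod \<zeta>"] by (simp add: norm_vector_scalar_mult)
    then show "\<exists>d. ((\<lambda>\<zeta>. \<psi> (\<zeta> *s u) $ j) has_field_derivative d) (at \<zeta>)"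
      using hol main unfolding holomorphic_map_on_def by (metis mem_ball_0)
  qed
  obtain f' where f': "(\<psi> has_derivative f') (at 0)" "Vector_Spaces.linear (*s) (*s) f'"
    using hol unfolding holomorphic_map_on_def by (metis centre_in_ball zero_less_one)
  have z: "0 *s u = 0" by (simp add: vec_eq_iff)
  have "jacobian \<psi> (at 0) = matrix f'"
    using f'(1) by (simp add: jacobian_def frechet_derivative_at[symmetric])
  then have "jacobian \<psi> (at 0) *v u = f' u" using f'(2) by (simp add: matrix_works)
  moreover have "deriv (\<lambda>\<zeta>. \<psi> (\<zeta> *s u) $ j) 0 = f' u $ j"
    using main[of f' 0] f' z by (intro DERIV_imp_deriv) simp
  ultimately show "deriv (\<lambda>\<zeta>. \<psi> (\<zeta> *s u) $ j) 0 = (jacobian \<psi> (at 0) *v u) $ j" by simp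
qed

text \<open>
  Testing with the normalised conjugate of the row.
\<close>

lemma row_norm_le:
  fixes A :: "complex ^ 'n::finite ^ 'm::finite"
  assumes "\<And>u. norm u = 1 \<Longrightarrow> cmod ((A *v u) $ i) \<le> B" and "B \<ge> 0"
  shows "norm (A $ i) \<le> B"
proof (cases "A $ i = 0")
  case False
  define c where "c = (\<chi> j. cnj (A $ i $ j))"
  have nc: "norm c = norm (A $ i)" by (simp add: c_def norm_vec_def)
  define u where "u = inverse (complex_of_real (norm (A $ i))) *s c"
  have "norm u = 1" using False by (simp add: u_def norm_vector_scalar_mult nc norm_inverse)
  moreover have "(A *v u) $ i = inverse (complex_of_real (norm (A $ i))) * (\<Sum>j\<in>UNIV. A $ i $ j * cnj (A $ i $ j))"
    by (simp add: matrix_vector_mult_def u_def c_def sum_distrib_left mult_ac)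
  then have "(A *v u) $ i = of_real (norm (A $ i))"
    using False unfolding of_real_norm_vec_square[symmetric] by (simp add: power2_eq_square)
  ultimately show ?thesis using assms(1)[of u] by simp
qed (use assms in simp)

lemma prod_option_UNIV:
  fixes g :: "'n::finite option \<Rightarrow> 'b::comm_monoid_mult"
  shows "(\<Prod>i\<in>UNIV. g i) = g None * (\<Prod>i\<in>UNIV. g (Some i))"
  by (simp add: UNIV_option_conv prod.reindex)

lemma bounded_linear_join:
  "bounded_linear (\<lambda>a. join a 0 :: complex ^ ('n::finite option))"
  "bounded_linear (\<lambda>b. join 0 b :: complex ^ ('n::finite option))"
proof -
  show "bounded_linear (\<lambda>a. join a 0 :: complex ^ ('n option))"
  proof (rule bounded_linear_intro[where K=1])
    show "norm (join a 0 :: complex ^ ('n option)) \<le> norm a * 1" for a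
      using norm_le_split[of "join a (0 :: complex ^ 'n)"] by simp
  qed (auto simp: join_def vec_eq_iff split: option.splits)
  show "bounded_linear (\<lambda>b. join 0 b :: complex ^ ('n option))"
  proof (rule bounded_linear_intro[where K=1])
    show "norm (join 0 b :: complex ^ ('n option)) \<le> norm b * 1" for b
      using norm_le_split[of "join 0 b"] by simp
  qed (auto simp: join_def vec_eq_iff split: option.splits)
qed

lemma product_map_holomorphic:
  fixes g :: "complex \<Rightarrow> complex" and b :: "complex ^ 'n::finite" and c :: real
  assumes g: "g holomorphic_on ball 0 1"
  defines "\<psi> \<equiv> \<lambda>w. join (g (fst_coord w)) (b + c *\<^sub>R rest_coords w)"
  shows "holomorphic_map_on (ball 0 1) \<psi>"
    and "det (jacobian \<psi> (at 0)) = deriv g 0 * of_real c ^ CARD('n)"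
proof -
  define A where "A = (\<lambda>d::complex. (\<chi> i j. if i = j then (case i of None \<Rightarrow> d | Some _ \<Rightarrow> of_real c) else 0)
    :: complex ^ ('n option) ^ ('n option))"
  have Av: "A d *v h = join (d * fst_coord h) 0 + join 0 (c *\<^sub>R rest_coords h)" for d h
    by (auto simp: A_def matrix_vector_mult_def join_def vec_eq_iff fst_coord_def rest_coords_def
      if_distrib[of "\<lambda>x. x * _"] scaleR_conv_of_real[where 'a=complex] cong: if_cong split: option.splits)
  have \<psi>: "\<psi> = (\<lambda>w. join (g (fst_coord w)) 0 + join 0 (b + c *\<^sub>R rest_coords w))"
    by (auto simp: \<psi>_def join_def vec_eq_iff split: option.splits)
  have main: "(\<psi> has_derivative (*v) (A (deriv g (fst_coord w)))) (at w)" if "w \<in> ball 0 1" for w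
  proof -
    have "fst_coord w \<in> ball 0 1" using that norm_fst_coord_le[of w] by simp
    then have "(g has_derivative (*) (deriv g (fst_coord w))) (at (fst_coord w))"
      using holomorphic_derivI[OF g open_ball] by (simp add: has_field_derivative_def)
    then have "((\<lambda>w. g (fst_coord w)) has_derivative (\<lambda>h. deriv g (fst_coord w) * fst_coord h)) (at w)"
      by (rule has_derivative_compose[OF bounded_linear_imp_has_derivative[OF bounded_linear_fst_coord]])
    from bounded_linear.has_derivative[OF bounded_linear_join(1) this]
    have 1: "((\<lambda>w. join (g (fst_coord w)) 0 :: complex ^ ('n option)) has_derivative
       (\<lambda>h. join (deriv g (fst_coord w) * fst_coord h) 0)) (at w)" .
    have "((\<lambda>w. b + c *\<^sub>R rest_coords w) has_derivative (\<lambda>h. 0 + c *\<^sub>R rest_coords h)) (at w)"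
      by (intro has_derivative_add has_derivative_const has_derivative_scaleR_right
        bounded_linear_imp_has_derivative bounded_linear_rest_coords)
    from bounded_linear.has_derivative[OF bounded_linear_join(2) this]
    have 2: "((\<lambda>w. join 0 (b + c *\<^sub>R rest_coords w)) has_derivative
       (\<lambda>h. join 0 (c *\<^sub>R rest_coords h))) (at w)" by simp
    have "(*v) (A (deriv g (fst_coord w))) =
        (\<lambda>h. join (deriv g (fst_coord w) * fst_coord h) 0 + join 0 (c *\<^sub>R rest_coords h))"
      by (rule ext) (rule Av)
    then show ?thesis using has_derivative_add[OF 1 2] by (simp only: \<psi>)
  qed
  show "holomorphic_map_on (ball 0 1) \<psi>"
    unfolding holomorphic_map_on_def using main matrix_vector_mul_linear_gen by blast
  have "jacobian \<psi> (at 0) = A (deriv g 0)"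
    using main[of 0] by (simp add: jacobian_def frechet_derivative_at[symmetric] coords_simps)
  moreover have "det (A (deriv g 0)) = (\<Prod>i\<in>UNIV. A (deriv g 0) $ i $ i)"
    by (rule det_diagonal) (simp add: A_def)
  ultimately show "det (jacobian \<psi> (at 0)) = deriv g 0 * of_real c ^ CARD('n)"
    by (simp add: prod_option_UNIV A_def)
qed

lemma Re_Cayley_pos:
  fixes v :: complex assumes "cmod v < 1"
  shows "Re (2 * v / (1 - v)) > - 1"
proof -
  have n: "1 - v \<noteq> 0" using assms by auto
  have "2 * v / (1 - v) + 1 = (1 + v) / (1 - v)" using n by (simp add: field_simps)
  then have "Re (2 * v / (1 - v)) + 1 = Re ((1 + v) / (1 - v))" by (metis plus_complex.sel(1) one_complex.sel(1))
  also have "\<dots> = (1 - (cmod v)\<^sup>2) / (cmod (1 - v))\<^sup>2"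
    unfolding cmod_power2 by (simp add: Re_divide power2_eq_square algebra_simps)
  also have "\<dots> > 0" using assms n by (simp add: power_less_one_iff abs_square_less_1)
  finally show ?thesis by simp
qed

context flat_boundary begin

text \<open>
  The peak function is \<open>P z = z\<^sub>1 + z\<^sub>1\<^sup>2\<close>. On the closure of \<open>D\<close> near \<open>0\<close> the real part of \<open>z\<^sub>1\<close> is at most \<open>- \<phi>(|z'|\<^sup>2)\<close>, which controls \<open>z'\<close>; the
  term \<open>z\<^sub>1\<^sup>2\<close> adds \<open>- (Im z\<^sub>1)\<^sup>2\<close>, which controls the remaining direction.
\<close>

lemma disc_localization:
  assumes r: "0 < r" "r < 1"
  obtains \<eta> where "\<eta> > 0" "\<And>f \<zeta>. (\<And>j. (\<lambda>z. f z $ j) holomorphic_on ball 0 1) \<Longrightarrow>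
    f ` ball 0 1 \<subseteq> D \<Longrightarrow> norm (f 0) < \<eta> \<Longrightarrow> cmod \<zeta> \<le> r \<Longrightarrow> norm (f \<zeta>) < s"
proof -
  \<comment> \<open>with |Re z1| at most 1/2, the sign of Re z1 + (Re z1)^2 is that of Re z1\<close>
  define s' where "s' = min s (1/2)"
  have s': "0 < s'" "s' \<le> s" "s' \<le> 1/2" using s_pos by (auto simp: s'_def)
  define P where "P = (\<lambda>z :: complex ^ ('n option). fst_coord z + (fst_coord z)\<^sup>2)"
  have ReP: "Re (P z) = ht z * (1 + ht z) - (Im (fst_coord z))\<^sup>2" for z
    by (simp add: P_def power2_eq_square algebra_simps)
  have ht: "- 1/2 \<le> ht z" "ht z \<le> 0" "\<phi> ((norm (rest_coords z))\<^sup>2) \<ge> 0"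
    if "norm z \<le> s'" "\<rho> z \<le> 0" for z
  proof -
    have n: "norm z < 2 * s" using that s' by simp
    show ge: "\<phi> ((norm (rest_coords z))\<^sup>2) \<ge> 0" using radius_bound[OF n] nonneg by simp
    then show "ht z \<le> 0" using that by (simp add: \<rho>_def)
    have "\<bar>ht z\<bar> \<le> 1/2" using abs_Re_le_cmod[of "fst_coord z"] norm_fst_coord_le[of z] that s' by linarith
    then show "- 1/2 \<le> ht z" by linarith
  qed
  have Pneg: "Re (P z) \<le> 0" if "norm z \<le> s'" "\<rho> z \<le> 0" for z
    using ht[OF that] mult_nonpos_nonneg[of "ht z" "1 + ht z"] zero_le_power2[of "Im (fst_coord z)"]
    unfolding ReP by linarith
  have Plt: "Re (P z) < 0" if "norm z = s'" "\<rho> z \<le> 0" for z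
  proof (rule ccontr)
    assume "\<not> ?thesis"
    note h = ht[of z, OF _ that(2)]
    have "ht z * (1 + ht z) \<le> 0" using h that by (intro mult_nonpos_nonneg) auto
    then have "ht z * (1 + ht z) = 0" "(Im (fst_coord z))\<^sup>2 = 0"
      using \<open>\<not> _\<close> zero_le_power2[of "Im (fst_coord z)"] unfolding ReP by linarith+
    then have h0: "ht z = 0" "Im (fst_coord z) = 0" using h that by auto
    have "\<phi> ((norm (rest_coords z))\<^sup>2) = 0" using h0 h that by (simp add: \<rho>_def)
    then have "rest_coords z = 0"
      using pos[of "(norm (rest_coords z))\<^sup>2"] radius_bound[of z] that s' by force
    with h0 have "norm z = 0" using norm_le_split[of z] by (simp add: cmod_eq_Re)
    then show False using that s' by simp
  qed
  define C where "C = sphere 0 s' \<inter> {z. \<rho> z \<le> 0}"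
  have "compact C" unfolding C_def
    by (intro compact_Int_closed compact_sphere closed_Collect_le continuous_on_\<rho> continuous_on_const)
  have contP: "continuous_on C (\<lambda>z. Re (P z))" unfolding P_def by (intro continuous_intros)
  obtain c where c: "c > 0" "\<And>z. z \<in> C \<Longrightarrow> Re (P z) \<le> - c"
  proof (cases "C = {}")
    case False
    then obtain z where z: "z \<in> C" "\<And>w. w \<in> C \<Longrightarrow> Re (P w) \<le> Re (P z)"
      using continuous_attains_sup[OF \<open>compact C\<close> _ contP] by blast
    then show ?thesis using that[of "- Re (P z)"] Plt[of z] by (simp add: C_def)
  qed (use that[of 1] in simp)
  obtain \<kappa> where \<kappa>: "\<kappa> > 0" "\<And>a. 0 < a \<Longrightarrow> a \<le> r \<Longrightarrow> (1 + a) / (2 * sqrt a) * a powr \<kappa> > 1"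
    using sqrt_AM_GM_gap[OF r] by blast
  define \<eta> where "\<eta> = min s' (\<kappa> * c / 2)"
  show thesis
  proof (rule that[of \<eta>])
    show "\<eta> > 0" using s' \<kappa> c by (simp add: \<eta>_def)
    fix f :: "complex \<Rightarrow> complex ^ ('n option)" and \<zeta>
    assume hol: "\<And>j. (\<lambda>z. f z $ j) holomorphic_on ball 0 1" and D: "f ` ball 0 1 \<subseteq> D"
      and n0: "norm (f 0) < \<eta>" and \<zeta>: "cmod \<zeta> \<le> r"
    have \<rho>f: "\<rho> (f z) \<le> 0" if "z \<in> ball 0 1" "norm (f z) \<le> s'" for z
      using D that in_D_iff[of "f z"] s' by (fastforce simp: image_subset_iff)
    have "norm (f \<zeta>) < s'"
    proof (rule disc_stays_near_peak_point[where g="\<lambda>z. P (f z)", OF hol _ _ _ c(1) _ r \<kappa>(2) _ \<zeta>])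
      show "(\<lambda>z. P (f z)) holomorphic_on ball 0 1"
        unfolding P_def fst_coord_def by (intro holomorphic_intros hol)
      show "Re (P (f z)) \<le> 0" if "z \<in> ball 0 1" "norm (f z) \<le> s'" for z
        using \<rho>f that Pneg by blast
      show "Re (P (f z)) \<le> - c" if "z \<in> ball 0 1" "norm (f z) = s'" for z
        using \<rho>f[of z] that by (intro c(2)) (simp add: C_def)
      show "norm (f 0) < s'" using n0 by (simp add: \<eta>_def)
      have m: "cmod (fst_coord (f 0)) \<le> norm (f 0)" by (rule norm_fst_coord_le)
      have "- Re (P (f 0)) \<le> cmod (P (f 0))" using abs_Re_le_cmod[of "P (f 0)"] by linarith
      also have "\<dots> \<le> cmod (fst_coord (f 0)) + (cmod (fst_coord (f 0)))\<^sup>2"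
        unfolding P_def by (rule order_trans[OF norm_triangle_ineq]) (simp add: norm_power)
      also have "\<dots> \<le> norm (f 0) + norm (f 0) * 1"
        using m n0 s' unfolding power2_eq_square by (intro add_mono mult_mono) (auto simp: \<eta>_def)
      also have "\<dots> \<le> \<kappa> * c" using n0 by (simp add: \<eta>_def)
      finally show "- Re (P (f 0)) \<le> \<kappa> * c" .
    qed
    then show "norm (f \<zeta>) < s" using s' by simp
  qed
qed

end

section \<open>Two-sided bounds for the volume element\<close>

context flat_boundary begin

text \<open>
  The first component maps the disc into the half-plane of height below \<open>- \<theta> x\<close>, via \<open>\<zeta> \<mapsto> (1 + \<zeta>) / (1 - \<zeta>)\<close> restricted to
  \<open>|\<zeta>| < r = 1 - \<theta>\<close>, so that its image has diameter \<open>O(x)\<close> and stays in the known part of \<open>D\<close>; the other components map the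
  ball to the ball of radius \<open>(1 - \<theta>) R\<close> around \<open>z'\<close>, over which the boundary has height above \<open>- \<theta> x\<close>.
\<close>

lemma kobayashi_competitor:
  assumes \<theta>: "0 < \<theta>" "\<theta> < 1"
  obtains \<eta> where "\<eta> > 0" "\<And>z R. admissible \<eta> z R \<Longrightarrow>
    \<exists>\<psi>. holomorphic_map_on (ball 0 1) \<psi> \<and> \<psi> ` ball 0 1 \<subseteq> D \<and> \<psi> 0 = z \<and>
      cmod (det (jacobian \<psi> (at 0))) = 2 * (1 - \<theta>)\<^sup>2 * \<phi> (R\<^sup>2) * ((1 - \<theta>) * R) ^ CARD('n)"
proof -
  obtain \<eta>1 where \<eta>1: "\<eta>1 > 0" "\<And>z R. admissible \<eta>1 z R \<Longrightarrow> z \<in> D \<and> norm z < s / 2 \<and> - ht z < s / 2 \<and>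
    R < 1/8 \<and> 4 * R\<^sup>2 < \<epsilon> \<and> R\<^sup>2 < \<epsilon> \<and> \<phi> (R\<^sup>2) > 0" by (rule admissible_in_D) (rule that)
  obtain \<eta>2 where \<eta>2: "\<eta>2 > 0" "\<And>R. 0 < R \<Longrightarrow> R < \<eta>2 \<Longrightarrow> \<phi> (((1 - \<theta>/2) * R)\<^sup>2) \<le> \<theta> * \<phi> (R\<^sup>2)"
  proof -
    have "0 < 1 - \<theta>/2" "1 - \<theta>/2 < 1" using \<theta> by auto
    then show thesis by (rule contraction_radius[OF _ _ \<theta>(1)]) (rule that)
  qed
  define \<eta> where "\<eta> = Min {\<eta>1, \<eta>2, \<theta> / 2, s / 2}"
  have le: "\<eta> \<le> \<eta>1" "\<eta> \<le> \<eta>2" "\<eta> \<le> \<theta> / 2" "\<eta> \<le> s / 2"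
    unfolding \<eta>_def by (rule Min_le; simp)+
  show thesis
  proof (rule that[of \<eta>])
    show "\<eta> > 0" using \<eta>1(1) \<eta>2(1) \<theta> s_pos by (simp add: \<eta>_def)
    fix z R assume adm: "admissible \<eta> z R"
    have a: "0 < R" "R < \<eta>2" "R < \<theta> / 2" "R < s / 2"
        "ht z = - \<phi> (R\<^sup>2)" "\<phi> (R\<^sup>2) \<le> R\<^sup>2" "norm (rest_coords z) \<le> R\<^sup>2"
      using adm le unfolding admissible_def by linarith+
    have "admissible \<eta>1 z R" using adm le(1) unfolding admissible_def by linarith
    note b = \<eta>1(2)[OF this]
    define x where "x = \<phi> (R\<^sup>2)"
    have x: "0 < x" "ht z = - x" "x \<le> R\<^sup>2" using a b by (auto simp: x_def)
    have RR: "R\<^sup>2 \<le> \<theta> / 2 * R" using a(1,3) by (simp add: power2_eq_square)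
    define X where "X = (1 - \<theta>) * x"
    have X: "0 < X" "X \<le> x" "- x + X = - (\<theta> * x)" using x \<theta> by (auto simp: X_def algebra_simps)
    define r where "r = 1 - \<theta>"
    have r: "0 < r" "r < 1" using \<theta> by (auto simp: r_def)
    define g where "g = (\<lambda>\<zeta>. fst_coord z - of_real X * (2 * (of_real r * \<zeta>) / (1 - of_real r * \<zeta>)))"
    have rz: "cmod (of_real r * \<zeta>) \<le> r" if "cmod \<zeta> < 1" for \<zeta>
      using that r by (simp add: norm_mult mult_left_le)
    have rz1: "cmod (of_real r * \<zeta>) < 1" if "cmod \<zeta> < 1" for \<zeta>
      using rz[OF that] r by simp
    have nz: "1 - of_real r * \<zeta> \<noteq> 0" if "cmod \<zeta> < 1" for \<zeta>
      using rz1[OF that] by auto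
    have holg: "g holomorphic_on ball 0 1"
      unfolding g_def using nz by (intro holomorphic_intros) auto
    have dg: "deriv g 0 = - of_real (2 * X * r)"
    proof (rule DERIV_imp_deriv)
      show "(g has_field_derivative - of_real (2 * X * r)) (at 0)"
        unfolding g_def by (auto intro!: derivative_eq_intros)
    qed
    define c where "c = (1 - \<theta>) * R"
    have c: "0 < c" using a(1) \<theta> by (simp add: c_def)
    define \<psi> where "\<psi> = (\<lambda>w. join (g (fst_coord w)) (rest_coords z + c *\<^sub>R rest_coords w))"
    note pm = product_map_holomorphic[OF holg, of "rest_coords z" c, folded \<psi>_def]
    have "\<psi> 0 = z" by (simp add: \<psi>_def g_def coords_simps)
    moreover have "cmod (det (jacobian \<psi> (at 0))) = 2 * (1 - \<theta>)\<^sup>2 * \<phi> (R\<^sup>2) * ((1 - \<theta>) * R) ^ CARD('n)"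
    proof -
      have "cmod (det (jacobian \<psi> (at 0))) = \<bar>2 * X * r\<bar> * \<bar>c\<bar> ^ CARD('n)"
        unfolding pm(2) dg norm_mult norm_minus_cancel norm_power norm_of_real ..
      also have "\<bar>2 * X * r\<bar> = 2 * (1 - \<theta>)\<^sup>2 * \<phi> (R\<^sup>2)"
        using X r by (simp add: X_def r_def x_def power2_eq_square)
      finally show ?thesis using c by (simp add: c_def)
    qed
    moreover have "\<psi> w \<in> D" if "w \<in> ball 0 1" for w
    proof -
      have nw: "norm w < 1" using that by simp
      have u: "cmod (fst_coord w) < 1" using nw norm_fst_coord_le[of w] by simp
      define v where "v = of_real r * fst_coord w"
      have v: "cmod v \<le> r" "cmod v < 1" using rz[OF u] rz1[OF u] by (auto simp: v_def)
      define y where "y = 2 * v / (1 - v)"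
      have gy: "g (fst_coord w) = fst_coord z - of_real X * y" by (simp add: g_def y_def v_def)
      have "Re y > - 1" unfolding y_def by (rule Re_Cayley_pos[OF v(2)])
      then have "X * Re y > X * (- 1)" using X(1) by (rule mult_strict_left_mono)
      then have h1: "ht (\<psi> w) < - (\<theta> * x)" using x X by (simp add: \<psi>_def gy)
      have "cmod y \<le> 2 / \<theta>"
      proof -
        have "\<theta> \<le> cmod (1 - v)" using norm_triangle_ineq2[of 1 v] v(1) by (simp add: r_def)
        moreover have "cmod (2 * v) \<le> 2" using v(2) by (simp add: norm_mult)
        ultimately show ?thesis unfolding y_def norm_divide using \<theta> by (intro frac_le) auto
      qed
      then have "X * cmod y \<le> X * (2 / \<theta>)" using X(1) by (intro mult_left_mono) auto
      also have "\<dots> \<le> R\<^sup>2 * (2 / \<theta>)" using X x \<theta> by (intro mult_right_mono) auto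
      also have "\<dots> \<le> (\<theta> / 2 * R) * (2 / \<theta>)" using RR \<theta> by (intro mult_right_mono) auto
      also have "\<dots> = R" using \<theta> by simp
      finally have Xy: "cmod (of_real X * y) \<le> R" using X(1) by (simp add: norm_mult)
      have rw: "norm (rest_coords w) \<le> 1" using nw norm_rest_coords_le[of w] by simp
      then have crw: "norm (c *\<^sub>R rest_coords w) \<le> c" using c by (simp add: mult_left_le)
      have "c \<le> R" using a(1) \<theta> by (simp add: c_def mult_left_le_one_le)
      have "\<psi> w - z = join (- of_real X * y) (c *\<^sub>R rest_coords w)"
        by (rule join_eqI) (simp_all add: \<psi>_def gy coords_simps)
      then have "norm (\<psi> w - z) \<le> 2 * R"
        using norm_le_split[of "\<psi> w - z"] Xy crw \<open>c \<le> R\<close> by simp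
      then have n: "norm (\<psi> w) < 2 * s" using norm_triangle_sub[of "\<psi> w" z] a b s_pos by linarith
      have "norm (rest_coords (\<psi> w)) \<le> norm (rest_coords z) + norm (c *\<^sub>R rest_coords w)"
        by (simp only: \<psi>_def join_simps norm_triangle_ineq)
      also have "\<dots> \<le> \<theta> / 2 * R + (1 - \<theta>) * R" using a(7) RR crw unfolding c_def by linarith
      also have "\<dots> = (1 - \<theta>/2) * R" by (simp add: algebra_simps)
      finally have "(norm (rest_coords (\<psi> w)))\<^sup>2 \<le> ((1 - \<theta>/2) * R)\<^sup>2" by (rule power_mono) simp
      moreover have "((1 - \<theta>/2) * R)\<^sup>2 < \<epsilon>"
      proof -
        have "((1 - \<theta>/2) * R)\<^sup>2 \<le> (1 * R)\<^sup>2" using \<theta> a(1) by (intro power_mono mult_right_mono) auto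
        then show ?thesis using b by simp
      qed
      ultimately have "\<phi> ((norm (rest_coords (\<psi> w)))\<^sup>2) \<le> \<phi> (((1 - \<theta>/2) * R)\<^sup>2)" by (intro mono) auto
      also have "\<dots> \<le> \<theta> * x" using \<eta>2(2) a by (simp add: x_def)
      finally have "\<rho> (\<psi> w) < 0" using h1 by (simp add: \<rho>_def)
      then show ?thesis using in_D_iff[OF n] by simp
    qed
    ultimately show "\<exists>\<psi>. holomorphic_map_on (ball 0 1) \<psi> \<and> \<psi> ` ball 0 1 \<subseteq> D \<and> \<psi> 0 = z \<and>
      cmod (det (jacobian \<psi> (at 0))) = 2 * (1 - \<theta>)\<^sup>2 * \<phi> (R\<^sup>2) * ((1 - \<theta>) * R) ^ CARD('n)"
      using pm(1) by (intro exI[of _ \<psi>]) auto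
  qed
qed

text \<open>
  With \<open>r = 1 / (1 + \<theta>)\<close>, competitors are controlled by the disc estimates on the radii \<open>r\<close> (half-plane) and \<open>r\<^sup>2\<close> (Harnack and Cauchy), along all
  complex lines through the centre.
\<close>

lemma kobayashi_det_bound:
  assumes \<theta>: "0 < \<theta>" "\<theta> < 1"
  obtains \<eta> where "\<eta> > 0" "\<And>z R \<psi>. admissible \<eta> z R \<Longrightarrow>
    holomorphic_map_on (ball 0 1) \<psi> \<Longrightarrow> \<psi> ` ball 0 1 \<subseteq> D \<Longrightarrow> \<psi> 0 = z \<Longrightarrow>
      cmod (det (jacobian \<psi> (at 0))) \<le> 2 * (1 + \<theta>) * \<phi> (R\<^sup>2) * ((1 + \<theta>) ^ 3 * R) ^ CARD('n)"
proof -
  define r where "r = 1 / (1 + \<theta>)"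
  have r: "0 < r" "r < 1" using \<theta> by (auto simp: r_def)
  \<comment> \<open>the Harnack constant for the circle of radius r^2 in the disc of radius r\<close>
  define K where "K = (1 + r) / (1 - r)"
  have K: "K > 0" using r by (simp add: K_def)
  obtain \<eta>1 where \<eta>1: "\<eta>1 > 0" "\<And>z R. admissible \<eta>1 z R \<Longrightarrow> z \<in> D \<and> norm z < s / 2 \<and> - ht z < s / 2 \<and>
    R < 1/8 \<and> 4 * R\<^sup>2 < \<epsilon> \<and> R\<^sup>2 < \<epsilon> \<and> \<phi> (R\<^sup>2) > 0" by (rule admissible_in_D) (rule that)
  have "0 < 1 / (2 * K)" using K by simp
  then obtain \<eta>2 where \<eta>2: "\<eta>2 > 0" "\<And>R. 0 < R \<Longrightarrow> R < \<eta>2 \<Longrightarrow> \<phi> ((r * R)\<^sup>2) \<le> 1 / (2 * K) * \<phi> (R\<^sup>2)"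
    by (rule contraction_radius[OF r]) (rule that)
  obtain \<eta>3 where \<eta>3: "\<eta>3 > 0" "\<And>f \<zeta>. (\<And>j. (\<lambda>z. f z $ j) holomorphic_on ball 0 1) \<Longrightarrow>
    f ` ball 0 1 \<subseteq> D \<Longrightarrow> norm (f 0) < \<eta>3 \<Longrightarrow> cmod \<zeta> \<le> r \<Longrightarrow> norm (f \<zeta>) < s"
    by (rule disc_localization[OF r]) blast
  define \<eta> where "\<eta> = Min {\<eta>1, \<eta>2 / 2, \<eta>3}"
  have le: "\<eta> \<le> \<eta>1" "\<eta> \<le> \<eta>2 / 2" "\<eta> \<le> \<eta>3"
    unfolding \<eta>_def by (rule Min_le; simp)+
  show thesis
  proof (rule that[of \<eta>])
    show "\<eta> > 0" using \<eta>1(1) \<eta>2(1) \<eta>3(1) by (simp add: \<eta>_def)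
    fix z R and \<psi> :: "complex ^ ('n option) \<Rightarrow> complex ^ ('n option)"
    assume adm: "admissible \<eta> z R" and hol: "holomorphic_map_on (ball 0 1) \<psi>"
      and D: "\<psi> ` ball 0 1 \<subseteq> D" and \<psi>0: "\<psi> 0 = z"
    have a: "0 < R" "R < \<eta>2 / 2" "norm z < \<eta>3" "ht z = - \<phi> (R\<^sup>2)"
      using adm le unfolding admissible_def by linarith+
    have "admissible \<eta>1 z R" using adm le(1) unfolding admissible_def by linarith
    note b = \<eta>1(2)[OF this]
    define x where "x = \<phi> (R\<^sup>2)"
    have x: "0 < x" "ht z = - x" using a b by (auto simp: x_def)
    \<comment> \<open>over the radius Q the boundary is already deeper than K x\<close>
    define Q where "Q = (1 + \<theta>) * R"
    have "Q \<le> 2 * R" using \<theta> a(1) unfolding Q_def by (intro mult_right_mono) auto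
    have Q: "0 < Q" "Q < \<eta>2" "Q\<^sup>2 < \<epsilon>"
    proof -
      show "0 < Q" using a(1) \<theta> by (simp add: Q_def)
      show "Q < \<eta>2" using \<open>Q \<le> 2 * R\<close> a(2) by linarith
      have "Q\<^sup>2 \<le> (2 * R)\<^sup>2" using \<open>Q \<le> 2 * R\<close> \<open>0 < Q\<close> by (intro power_mono) auto
      then show "Q\<^sup>2 < \<epsilon>" using b by simp
    qed
    have "r * Q = R" using \<theta> by (simp add: r_def Q_def)
    then have "x \<le> 1 / (2 * K) * \<phi> (Q\<^sup>2)" using \<eta>2(2)[OF Q(1,2)] by (simp add: x_def)
    then have "2 * (K * x) \<le> \<phi> (Q\<^sup>2)" using K by (simp add: field_simps)
    moreover have "0 < K * x" using K x(1) by simp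
    ultimately have KQ: "K * x < \<phi> (Q\<^sup>2)" by linarith
    define A where "A = jacobian \<psi> (at 0)"
    have row: "norm (A $ None) \<le> 2 * x / r" "\<And>i. norm (A $ Some i) \<le> Q / r\<^sup>2"
    proof -
      have slice: "cmod ((A *v u) $ None) \<le> 2 * x / r \<and> (\<forall>i. cmod ((A *v u) $ Some i) \<le> Q / r\<^sup>2)"
        if u: "norm u = 1" for u
      proof -
        define f where "f = (\<lambda>\<zeta>. \<psi> (\<zeta> *s u))"
        have holf: "(\<lambda>\<zeta>. f \<zeta> $ j) holomorphic_on ball 0 1"
          and df: "deriv (\<lambda>\<zeta>. f \<zeta> $ j) 0 = (A *v u) $ j" for j
          using holomorphic_map_slice[OF hol, of u j] u by (auto simp: f_def A_def)
        have fD: "f \<zeta> \<in> D" if "cmod \<zeta> < 1" for \<zeta>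
          using D that u by (auto simp: f_def image_subset_iff norm_vector_scalar_mult)
        have f0: "f 0 = z" using \<psi>0 by (simp add: f_def)
        have fs: "norm (f \<zeta>) < s" if "cmod \<zeta> \<le> r" for \<zeta>
        proof -
          have "f ` ball 0 1 \<subseteq> D" using fD by auto
          from \<eta>3(2)[OF holf this _ that] show ?thesis using a(3) f0 by simp
        qed
        have \<rho>f: "ht (f \<zeta>) + \<phi> ((norm (rest_coords (f \<zeta>)))\<^sup>2) < 0"
            "\<phi> ((norm (rest_coords (f \<zeta>)))\<^sup>2) \<ge> 0" if "cmod \<zeta> \<le> r" for \<zeta>
        proof -
          have n: "norm (f \<zeta>) < 2 * s" using fs[OF that] s_pos by simp
          show "ht (f \<zeta>) + \<phi> ((norm (rest_coords (f \<zeta>)))\<^sup>2) < 0"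
            using fD[of \<zeta>] that r local_D[OF n] by simp
          show "\<phi> ((norm (rest_coords (f \<zeta>)))\<^sup>2) \<ge> 0" using radius_bound[OF n] nonneg by simp
        qed
        have neg: "Re (f \<zeta> $ None) < 0" if "\<zeta> \<in> ball 0 r" for \<zeta>
          using \<rho>f[of \<zeta>] that by (simp add: fst_coord_def)
        have sub: "ball 0 r \<subseteq> (ball 0 1 :: complex set)" using r by auto
        have hp: "cmod (deriv (\<lambda>\<zeta>. f \<zeta> $ None) 0) \<le> 2 * (- Re (f 0 $ None)) / r"
          by (rule half_plane_deriv_bound[OF holomorphic_on_subset[OF holf sub] r(1)]) (rule neg)
        have hp2: "- Re (f \<zeta> $ None) \<le> (- Re (f 0 $ None)) * ((r + cmod \<zeta>) / (r - cmod \<zeta>))"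
          if "\<zeta> \<in> ball 0 r" for \<zeta>
          by (rule half_plane_Harnack[OF holomorphic_on_subset[OF holf sub] r(1) neg that])
        have x': "- Re (f 0 $ None) = x" using x f0 by (simp add: fst_coord_def)
        have 1: "cmod ((A *v u) $ None) \<le> 2 * x / r"
          using hp unfolding df x' .
        have inQ: "norm (rest_coords (f \<zeta>)) \<le> Q" if "cmod \<zeta> = r\<^sup>2" for \<zeta>
        proof (rule ccontr)
          assume "\<not> ?thesis"
          then have "Q\<^sup>2 \<le> (norm (rest_coords (f \<zeta>)))\<^sup>2" using Q by (intro power_mono) auto
          have "r\<^sup>2 < r" using r by (simp add: power2_eq_square)
          then have zr: "\<zeta> \<in> ball 0 r" "cmod \<zeta> \<le> r" using that by auto
          have n: "norm (f \<zeta>) < 2 * s" using fs[OF zr(2)] s_pos by simp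
          have "\<phi> (Q\<^sup>2) \<le> \<phi> ((norm (rest_coords (f \<zeta>)))\<^sup>2)"
            using \<open>Q\<^sup>2 \<le> _\<close> radius_bound[OF n] by (intro mono) auto
          also have "\<dots> < - Re (f \<zeta> $ None)" using \<rho>f(1)[OF zr(2)] by (simp add: fst_coord_def)
          also have "\<dots> \<le> x * ((r + r\<^sup>2) / (r - r\<^sup>2))" using hp2[OF zr(1)] unfolding x' that .
          also have "(r + r\<^sup>2) / (r - r\<^sup>2) = (r * (1 + r)) / (r * (1 - r))"
            by (simp add: power2_eq_square algebra_simps)
          also have "\<dots> = K" using r by (simp add: K_def)
          finally show False using KQ by (simp add: mult.commute)
        qed
        have 2: "cmod ((A *v u) $ Some i) \<le> Q / r\<^sup>2" for i
        proof -
          have r2: "0 < r\<^sup>2" "r\<^sup>2 < 1" using r by (auto simp: power_less_one_iff)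
          have "cmod ((deriv ^^ 1) (\<lambda>\<zeta>. f \<zeta> $ Some i) 0) \<le> fact 1 * Q / (r\<^sup>2) ^ 1"
          proof (rule Cauchy_inequality)
            show "(\<lambda>\<zeta>. f \<zeta> $ Some i) holomorphic_on ball 0 (r\<^sup>2)"
              using holf r2 by (rule_tac holomorphic_on_subset) auto
            show "continuous_on (cball 0 (r\<^sup>2)) (\<lambda>\<zeta>. f \<zeta> $ Some i)"
              using holf r2 by (intro holomorphic_on_imp_continuous_on) (rule_tac holomorphic_on_subset, auto)
            show "cmod (f \<zeta> $ Some i) \<le> Q" if "cmod (0 - \<zeta>) = r\<^sup>2" for \<zeta>
            proof -
              have "cmod (rest_coords (f \<zeta>) $ i) \<le> norm (rest_coords (f \<zeta>))" by (rule Finite_Cartesian_Product.norm_nth_le)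
              then show ?thesis using inQ[of \<zeta>] that by (simp add: rest_coords_def)
            qed
          qed (rule r2)
          then show ?thesis by (simp add: df)
        qed
        show ?thesis using 1 2 by blast
      qed
      show "norm (A $ None) \<le> 2 * x / r" using slice x r by (intro row_norm_le) auto
      show "norm (A $ Some i) \<le> Q / r\<^sup>2" for i using slice Q r by (intro row_norm_le) auto
    qed
    have "cmod (det A) \<le> norm (A $ None) * (\<Prod>i\<in>UNIV. norm (A $ Some i))"
      using Hadamard_det_bound[of A] by (simp add: prod_option_UNIV)
    also have "\<dots> \<le> (2 * x / r) * (\<Prod>i\<in>(UNIV :: 'n set). Q / r\<^sup>2)"
      using row x r by (intro mult_mono prod_mono) (auto intro!: prod_nonneg)
    also have "2 * x / r = 2 * (1 + \<theta>) * \<phi> (R\<^sup>2)" by (simp add: r_def x_def)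
    also have "Q / r\<^sup>2 = (1 + \<theta>) ^ 3 * R"
      by (simp add: r_def Q_def power2_eq_square power3_eq_cube)
    finally show "cmod (det (jacobian \<psi> (at 0))) \<le> 2 * (1 + \<theta>) * \<phi> (R\<^sup>2) * ((1 + \<theta>) ^ 3 * R) ^ CARD('n)"
      by (simp add: A_def)
  qed
qed

text \<open>
  Strict monotonicity of \<open>\<phi>\<close> makes the number unique. If there is none, the value is arbitrary.
\<close>

definition radius :: "complex ^ ('n option) \<Rightarrow> real"
  where "radius z = (SOME R. 0 < R \<and> R\<^sup>2 < \<epsilon> \<and> \<phi> (R\<^sup>2) = - ht z)"

lemma radius_eq:
  assumes "0 < R" "R\<^sup>2 < \<epsilon>" "\<phi> (R\<^sup>2) = - ht z"
  shows "radius z = R"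
  unfolding radius_def
proof (rule some_equality)
  fix R' assume R': "0 < R' \<and> R'\<^sup>2 < \<epsilon> \<and> \<phi> (R'\<^sup>2) = - ht z"
  then have "\<not> R'\<^sup>2 < R\<^sup>2" "\<not> R\<^sup>2 < R'\<^sup>2"
    using strict_mono[of "R'\<^sup>2" "R\<^sup>2"] strict_mono[of "R\<^sup>2" "R'\<^sup>2"] assms by auto
  then have "R'\<^sup>2 = R\<^sup>2" by simp
  then show "R' = R" using R' assms(1) by (simp add: power2_eq_iff)
qed (use assms in simp)

text \<open>
  If \<open>|z'|\<close> were at least \<open>R\<^sup>2\<close>, the cone condition would give \<open>\<phi>(R\<^sup>2) > \<alpha> R\<^sup>2\<^sup>N\<close>, contrary to the decay of \<open>\<phi>\<close> faster than every power.
\<close>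

lemma cone_admissible:
  assumes "\<alpha> > 0" "N > 0" "\<eta> > 0"
  obtains \<delta> where "\<delta> > 0" "\<And>z :: complex ^ ('n option). norm z < \<delta> \<Longrightarrow> z \<in> cone \<alpha> N \<Longrightarrow> admissible \<eta> z (radius z)"
proof -
  have "\<forall>\<^sub>F y in at_right 0. \<phi> y \<le> y powr (N + 1) \<and> \<phi> y \<le> y powr 1"
    using power_decay[of "N + 1"] power_decay[of 1] assms by (simp add: eventually_conj)
  then obtain y1 where y1: "y1 > 0" "\<And>y. 0 < y \<Longrightarrow> y < y1 \<Longrightarrow> \<phi> y \<le> y powr (N + 1) \<and> \<phi> y \<le> y powr 1"
    using eventually_at_right_0_obtain by blast
  define m where "m = min (min y1 \<epsilon>) \<alpha>"
  have m: "m > 0" "m \<le> y1" "m \<le> \<epsilon>" "m \<le> \<alpha>" using y1 \<epsilon>_pos assms by (auto simp: m_def)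
  define b where "b = min \<eta> (sqrt (m / 2))"
  have b: "0 < b" "b \<le> \<eta>" using assms m by (auto simp: b_def)
  have "b\<^sup>2 \<le> (sqrt (m / 2))\<^sup>2" using b by (intro power_mono) (auto simp: b_def)
  then have b2: "b\<^sup>2 < m" "0 < b\<^sup>2" using m b by auto
  have "\<phi> (b\<^sup>2) > 0" using b2 m by (intro pos) auto
  define \<delta> where "\<delta> = min \<eta> (\<phi> (b\<^sup>2))"
  show thesis
  proof (rule that[of \<delta>])
    show "\<delta> > 0" using assms \<open>\<phi> (b\<^sup>2) > 0\<close> by (simp add: \<delta>_def)
    fix z :: "complex ^ ('n option)" assume n: "norm z < \<delta>" and "z \<in> cone \<alpha> N"
    then have cz: "ht z < - \<alpha> * norm (rest_coords z) powr N" by (simp add: cone_def)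
    define x where "x = - ht z"
    have x\<alpha>: "\<alpha> * norm (rest_coords z) powr N < x" using cz by (simp add: x_def)
    have "0 \<le> \<alpha> * norm (rest_coords z) powr N" using assms by simp
    then have "0 < x" using x\<alpha> by linarith
    have "x \<le> norm z" unfolding x_def
      using abs_Re_le_cmod[of "fst_coord z"] norm_fst_coord_le[of z] by linarith
    then have "x < \<phi> (b\<^sup>2)" using n by (simp add: \<delta>_def)
    obtain y where y: "0 \<le> y" "y \<le> b\<^sup>2" "\<phi> y = x"
      using IVT[of \<phi> 0 x "b\<^sup>2"] zero \<open>0 < x\<close> \<open>x < \<phi> (b\<^sup>2)\<close> isCont b2 by auto
    have "y \<noteq> 0" "y \<noteq> b\<^sup>2" using y zero \<open>0 < x\<close> \<open>x < \<phi> (b\<^sup>2)\<close> by auto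
    then have y': "0 < y" "y < b\<^sup>2" using y by auto
    define R where "R = sqrt y"
    have R: "0 < R" "R\<^sup>2 = y" using y' by (auto simp: R_def)
    have "R < b" using R y' b by (metis power_less_imp_less_base less_imp_le)
    have y\<epsilon>: "y < \<epsilon>" "y < y1" "y < \<alpha>" using y' b2 m by auto
    have rad: "radius z = R" using R y\<epsilon> y by (intro radius_eq) (auto simp: x_def)
    have "x \<le> y" using y1(2)[of y] y' y\<epsilon> y by simp
    have "\<alpha> * norm (rest_coords z) powr N < \<alpha> * y powr N"
    proof -
      have "\<alpha> * norm (rest_coords z) powr N < x" by (rule x\<alpha>)
      also have "x \<le> y powr (N + 1)" using y1(2)[of y] y' y\<epsilon> y by simp
      also have "\<dots> = y powr N * y" using y' by (simp add: powr_add)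
      also have "\<dots> \<le> y powr N * \<alpha>" using y\<epsilon> by (intro mult_left_mono) auto
      finally show ?thesis by (simp add: mult.commute)
    qed
    then have "norm (rest_coords z) powr N < y powr N" using assms by simp
    then have "norm (rest_coords z) < y"
      using powr_mono2[of N y "norm (rest_coords z)"] assms y' by (meson less_imp_le not_less)
    then show "admissible \<eta> z (radius z)"
      unfolding admissible_def rad R(2)
      using R(1) \<open>R < b\<close> b y \<open>x \<le> y\<close> n by (auto simp: x_def \<delta>_def)
  qed
qed


section \<open>The limit\<close>

definition volume_ratio :: "complex ^ ('n option) \<Rightarrow> real"
  where "volume_ratio z = kobayashi_eisenman D z /
    (normal_distance D z powi (- 2) * tangential_distance D z powi (- 2 * int CARD('n)))"

text \<open>
  All four estimates hold up to factors that tend to 1 with \<open>\<theta>\<close>; the exponents record how often each factor enters.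
\<close>

lemma volume_ratio_bounds:
  assumes \<theta>: "0 < \<theta>" "\<theta> < 1"
  defines "n \<equiv> CARD('n)"
  obtains \<eta> where "\<eta> > 0" "\<And>z R. admissible \<eta> z R \<Longrightarrow>
    ((1 - \<theta>) * (1 - \<theta>) ^ n / ((1 + \<theta>) * (1 + \<theta>) ^ (3 * n)))\<^sup>2 / 4 \<le> volume_ratio z \<and>
    volume_ratio z \<le> ((1 + \<theta>) ^ n / ((1 - \<theta>)\<^sup>2 * (1 - \<theta>) ^ n))\<^sup>2 / 4"
proof -
  obtain \<eta>1 where \<eta>1: "\<eta>1 > 0" "\<And>z R. admissible \<eta>1 z R \<Longrightarrow> z \<in> D \<and> norm z < s / 2 \<and> - ht z < s / 2 \<and>
    R < 1/8 \<and> 4 * R\<^sup>2 < \<epsilon> \<and> R\<^sup>2 < \<epsilon> \<and> \<phi> (R\<^sup>2) > 0" by (rule admissible_in_D) (rule that)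
  obtain \<eta>2 where \<eta>2: "\<eta>2 > 0" "\<And>z R. admissible \<eta>2 z R \<Longrightarrow>
    (1 - \<theta>) * \<phi> (R\<^sup>2) \<le> normal_distance D z \<and> normal_distance D z \<le> \<phi> (R\<^sup>2)"
    by (rule normal_distance_asymp[OF \<theta>]) (rule that)
  obtain \<eta>3 where \<eta>3: "\<eta>3 > 0" "\<And>z R. admissible \<eta>3 z R \<Longrightarrow>
    (1 - \<theta>) * R \<le> tangential_distance D z \<and> tangential_distance D z \<le> (1 + \<theta>) * R"
    by (rule tangential_distance_asymp[OF \<theta>]) (rule that)
  obtain \<eta>4 where \<eta>4: "\<eta>4 > 0" "\<And>z R. admissible \<eta>4 z R \<Longrightarrow>
    \<exists>\<psi>. holomorphic_map_on (ball 0 1) \<psi> \<and> \<psi> ` ball 0 1 \<subseteq> D \<and> \<psi> 0 = z \<and>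
      cmod (det (jacobian \<psi> (at 0))) = 2 * (1 - \<theta>)\<^sup>2 * \<phi> (R\<^sup>2) * ((1 - \<theta>) * R) ^ CARD('n)"
    by (rule kobayashi_competitor[OF \<theta>]) (rule that)
  obtain \<eta>5 where \<eta>5: "\<eta>5 > 0" "\<And>z R \<psi>. admissible \<eta>5 z R \<Longrightarrow>
    holomorphic_map_on (ball 0 1) \<psi> \<Longrightarrow> \<psi> ` ball 0 1 \<subseteq> D \<Longrightarrow> \<psi> 0 = z \<Longrightarrow>
      cmod (det (jacobian \<psi> (at 0))) \<le> 2 * (1 + \<theta>) * \<phi> (R\<^sup>2) * ((1 + \<theta>) ^ 3 * R) ^ CARD('n)"
    by (rule kobayashi_det_bound[OF \<theta>]) (rule that)
  define \<eta> where "\<eta> = Min {\<eta>1, \<eta>2, \<eta>3, \<eta>4, \<eta>5}"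
  have le: "\<eta> \<le> \<eta>1" "\<eta> \<le> \<eta>2" "\<eta> \<le> \<eta>3" "\<eta> \<le> \<eta>4" "\<eta> \<le> \<eta>5"
    unfolding \<eta>_def by (rule Min_le; simp)+
  show thesis
  proof (rule that[of \<eta>])
    show "\<eta> > 0" using \<eta>1(1) \<eta>2(1) \<eta>3(1) \<eta>4(1) \<eta>5(1) by (simp add: \<eta>_def)
    fix z R assume adm: "admissible \<eta> z R"
    have adm': "admissible \<eta>' z R" if "\<eta> \<le> \<eta>'" for \<eta>'
      using adm that unfolding admissible_def by linarith
    have R: "0 < R" using adm by (simp add: admissible_def)
    define x where "x = \<phi> (R\<^sup>2)"
    have x: "0 < x" using \<eta>1(2)[OF adm'[OF le(1)]] by (simp add: x_def)
    define d where "d = normal_distance D z"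
    define e where "e = tangential_distance D z"
    have d: "(1 - \<theta>) * x \<le> d" "d \<le> x" using \<eta>2(2)[OF adm'[OF le(2)]] by (auto simp: x_def d_def)
    have e: "(1 - \<theta>) * R \<le> e" "e \<le> (1 + \<theta>) * R" using \<eta>3(2)[OF adm'[OF le(3)]] by (auto simp: e_def)
    define k where "k = kobayashi_eisenman D z"
    define J where "J = {cmod (det (jacobian \<psi> (at 0))) powi (-2) | \<psi> :: complex ^ ('n option) \<Rightarrow> complex ^ ('n option).
      holomorphic_map_on (ball 0 1) \<psi> \<and> \<psi> ` ball 0 1 \<subseteq> D \<and> \<psi> 0 = z \<and>
      det (jacobian \<psi> (at 0)) \<noteq> 0}"
    have k: "k = Inf J" by (simp add: k_def J_def kobayashi_eisenman_def)
    have powi: "a powi (-2) = inverse (a\<^sup>2)" for a :: real by (simp add: power_int_minus)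
    define lo where "lo = 2 * (1 - \<theta>)\<^sup>2 * x * ((1 - \<theta>) * R) ^ n"
    define hi where "hi = 2 * (1 + \<theta>) * x * ((1 + \<theta>) ^ 3 * R) ^ n"
    have pos: "0 < lo" "0 < hi" using \<theta> x R by (auto simp: lo_def hi_def)
    have loJ: "inverse (lo\<^sup>2) \<in> J"
    proof -
      obtain \<psi> where \<psi>: "holomorphic_map_on (ball 0 1) \<psi>" "\<psi> ` ball 0 1 \<subseteq> D" "\<psi> 0 = z"
        "cmod (det (jacobian \<psi> (at 0))) = lo"
        using \<eta>4(2)[OF adm'[OF le(4)]] by (auto simp: lo_def x_def n_def)
      moreover have "det (jacobian \<psi> (at 0)) \<noteq> 0" using \<psi>(4) pos by auto
      ultimately show ?thesis unfolding J_def using powi[of lo] by force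
    qed
    have "bdd_below J" by (rule bdd_belowI[of _ 0]) (auto simp: J_def powi)
    then have kle: "k \<le> inverse (lo\<^sup>2)" unfolding k using loJ by (intro cInf_lower)
    have kge: "inverse (hi\<^sup>2) \<le> k"
      unfolding k
    proof (rule cInf_greatest)
      fix j assume "j \<in> J"
      then obtain \<psi> where \<psi>: "j = inverse ((cmod (det (jacobian \<psi> (at 0))))\<^sup>2)"
        "holomorphic_map_on (ball 0 1) \<psi>" "\<psi> ` ball 0 1 \<subseteq> D" "\<psi> 0 = z" "det (jacobian \<psi> (at 0)) \<noteq> 0"
        by (auto simp: J_def powi)
      have "cmod (det (jacobian \<psi> (at 0))) \<le> hi"
        using \<eta>5(2)[OF adm'[OF le(5)] \<psi>(2-4)] by (simp add: hi_def x_def n_def)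
      then have "(cmod (det (jacobian \<psi> (at 0))))\<^sup>2 \<le> hi\<^sup>2" by (intro power_mono) auto
      then show "inverse (hi\<^sup>2) \<le> j" unfolding \<psi>(1) using \<psi>(5) by (intro le_imp_inverse_le) auto
    qed (use loJ in auto)
    have quot: "volume_ratio z = k * (d * e ^ n)\<^sup>2"
    proof -
      have "e powi (- 2 * int n) = inverse ((e ^ n)\<^sup>2)"
      proof -
        have "- 2 * int n = - int (n * 2)" by simp
        then show ?thesis by (simp only: power_int_minus power_int_of_nat power_mult)
      qed
      then have "volume_ratio z = k / (inverse (d\<^sup>2) * inverse ((e ^ n)\<^sup>2))"
        unfolding volume_ratio_def n_def[symmetric] d_def[symmetric] e_def[symmetric] k_def[symmetric] powi
        by simp
      also have "\<dots> = k * (d\<^sup>2 * (e ^ n)\<^sup>2)" by (simp only: divide_inverse inverse_mult_distrib inverse_inverse_eq)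
      finally show ?thesis by (simp only: power_mult_distrib)
    qed
    have d0: "0 < d" using d(1) x \<theta> by (smt (verit) mult_pos_pos)
    have e0: "0 < e" using e(1) R \<theta> by (smt (verit) mult_pos_pos)
    have sq: "inverse (b\<^sup>2) * a\<^sup>2 = (a / b)\<^sup>2" for a b :: real
      unfolding power_divide by (simp add: divide_inverse mult.commute)
    have "volume_ratio z \<le> inverse (lo\<^sup>2) * (d * e ^ n)\<^sup>2" unfolding quot by (intro mult_right_mono kle) auto
    also have "\<dots> \<le> inverse (lo\<^sup>2) * (x * ((1 + \<theta>) * R) ^ n)\<^sup>2"
      using d e d0 e0 x by (intro mult_left_mono power_mono mult_mono) auto
    also have "\<dots> = ((x * ((1 + \<theta>) * R) ^ n) / lo)\<^sup>2" by (rule sq)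
    also have "(x * ((1 + \<theta>) * R) ^ n) / lo = (1 + \<theta>) ^ n / ((1 - \<theta>)\<^sup>2 * (1 - \<theta>) ^ n) / 2"
      using x R by (simp add: lo_def power_mult_distrib)
    finally have upper: "volume_ratio z \<le> ((1 + \<theta>) ^ n / ((1 - \<theta>)\<^sup>2 * (1 - \<theta>) ^ n))\<^sup>2 / 4"
      by (simp add: power_divide)
    have "((1 - \<theta>) * (1 - \<theta>) ^ n / ((1 + \<theta>) * (1 + \<theta>) ^ (3 * n)))\<^sup>2 / 4
        = ((1 - \<theta>) * (1 - \<theta>) ^ n / ((1 + \<theta>) * (1 + \<theta>) ^ (3 * n)) / 2)\<^sup>2"
      by (simp add: power_divide)
    also have "(1 - \<theta>) * (1 - \<theta>) ^ n / ((1 + \<theta>) * (1 + \<theta>) ^ (3 * n)) / 2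
        = ((1 - \<theta>) * x * ((1 - \<theta>) * R) ^ n) / hi"
      using x R by (simp add: hi_def power_mult_distrib power_mult)
    also have "(((1 - \<theta>) * x * ((1 - \<theta>) * R) ^ n) / hi)\<^sup>2 = inverse (hi\<^sup>2) * ((1 - \<theta>) * x * ((1 - \<theta>) * R) ^ n)\<^sup>2"
      by (rule sq[symmetric])
    also have "\<dots> \<le> inverse (hi\<^sup>2) * (d * e ^ n)\<^sup>2"
      using d e d0 e0 x R \<theta> by (intro mult_left_mono power_mono mult_mono) auto
    also have "\<dots> \<le> volume_ratio z" unfolding quot by (intro mult_right_mono kge) auto
    finally show "((1 - \<theta>) * (1 - \<theta>) ^ n / ((1 + \<theta>) * (1 + \<theta>) ^ (3 * n)))\<^sup>2 / 4 \<le> volume_ratio z \<and>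
      volume_ratio z \<le> ((1 + \<theta>) ^ n / ((1 - \<theta>)\<^sup>2 * (1 - \<theta>) ^ n))\<^sup>2 / 4" using upper by simp
  qed
qed

lemma volume_ratio_tendsto:
  assumes lim: "(\<gamma> \<longlongrightarrow> 0) F" and cone: "\<forall>\<^sub>F t in F. \<gamma> t \<in> cone \<alpha> N" and "\<alpha> > 0" "N > 0"
  shows "((\<lambda>t. volume_ratio (\<gamma> t)) \<longlongrightarrow> 1 / 4) F"
proof -
  define n where "n = CARD('n)"
  define L where "L = (\<lambda>\<theta>::real. ((1 - \<theta>) * (1 - \<theta>) ^ n / ((1 + \<theta>) * (1 + \<theta>) ^ (3 * n)))\<^sup>2 / 4)"
  define U where "U = (\<lambda>\<theta>::real. ((1 + \<theta>) ^ n / ((1 - \<theta>)\<^sup>2 * (1 - \<theta>) ^ n))\<^sup>2 / 4)"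
  have LU: "(L \<longlongrightarrow> 1 / 4) (at_right 0)" "(U \<longlongrightarrow> 1 / 4) (at_right 0)"
    unfolding L_def U_def by (auto intro!: tendsto_eq_intros)
  have bounds: "\<forall>\<^sub>F t in F. L \<theta> \<le> volume_ratio (\<gamma> t) \<and> volume_ratio (\<gamma> t) \<le> U \<theta>" if \<theta>: "0 < \<theta>" "\<theta> < 1" for \<theta>
  proof -
    obtain \<eta> where \<eta>: "\<eta> > 0" "\<And>z R. admissible \<eta> z R \<Longrightarrow> L \<theta> \<le> volume_ratio z \<and> volume_ratio z \<le> U \<theta>"
      by (rule volume_ratio_bounds[OF \<theta>]) (rule that[unfolded L_def U_def n_def])
    obtain \<delta> where \<delta>: "\<delta> > 0" "\<And>z :: complex ^ ('n option). norm z < \<delta> \<Longrightarrow> z \<in> cone \<alpha> N \<Longrightarrow> admissible \<eta> z (radius z)"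
      by (rule cone_admissible[OF \<open>\<alpha> > 0\<close> \<open>N > 0\<close> \<eta>(1)]) (rule that)
    have "\<forall>\<^sub>F t in F. norm (\<gamma> t) < \<delta>"
      using tendstoD[OF lim \<delta>(1)] by simp
    with cone show ?thesis by eventually_elim (use \<delta>(2) \<eta>(2) in blast)
  qed
  have small: "\<forall>\<^sub>F \<theta>::real in at_right 0. 0 < \<theta> \<and> \<theta> < 1"
    unfolding eventually_at_right_field by (rule exI[of _ 1]) simp
  show ?thesis
  proof (rule order_tendstoI)
    fix a :: real assume "a < 1 / 4"
    from order_tendstoD(1)[OF LU(1) this] small have "\<forall>\<^sub>F \<theta> in at_right 0. a < L \<theta> \<and> 0 < \<theta> \<and> \<theta> < 1"
      by eventually_elim simp
    then obtain \<theta> where "a < L \<theta>" "0 < \<theta>" "\<theta> < 1" using eventually_happens'[of "at_right (0::real)"] by fastforce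
    then show "\<forall>\<^sub>F t in F. a < volume_ratio (\<gamma> t)" using bounds[of \<theta>] by (auto elim!: eventually_mono)
  next
    fix a :: real assume "1 / 4 < a"
    from order_tendstoD(2)[OF LU(2) this] small have "\<forall>\<^sub>F \<theta> in at_right 0. U \<theta> < a \<and> 0 < \<theta> \<and> \<theta> < 1"
      by eventually_elim simp
    then obtain \<theta> where "U \<theta> < a" "0 < \<theta>" "\<theta> < 1" using eventually_happens'[of "at_right (0::real)"] by fastforce
    then show "\<forall>\<^sub>F t in F. volume_ratio (\<gamma> t) < a" using bounds[of \<theta>] by (auto elim!: eventually_mono)
  qed
qed

end

lemma exponentially_flat_imp_flat_boundary:
  assumes "open D" "exponentially_flat_boundary_point D"
  obtains \<phi> \<epsilon> s where "flat_boundary \<phi> (deriv \<phi>) \<epsilon> D s"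
proof -
  obtain U \<phi> where U: "open U" "0 \<in> U" and "exponentially_flat \<phi>"
    and DU: "D \<inter> U = {z \<in> U. Re (fst_coord z) + \<phi> (\<Sum>i\<in>UNIV. (cmod (rest_coords z $ i))\<^sup>2) < 0}"
    using assms(2) by (auto simp: exponentially_flat_boundary_point_def)
  obtain \<epsilon> where "flat_profile \<phi> (deriv \<phi>) \<epsilon>"
    using exponentially_flat_imp_flat_profile[OF \<open>exponentially_flat \<phi>\<close>] by blast
  then interpret flat_profile \<phi> "deriv \<phi>" \<epsilon> .
  obtain r where r: "r > 0" "ball 0 r \<subseteq> U" using U by (meson openE)
  define s where "s = min (r / 2) (sqrt (\<epsilon> / 5))"
  have s: "s > 0" "2 * s \<le> r" using r \<epsilon>_pos by (auto simp: s_def)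
  have "s\<^sup>2 \<le> (sqrt (\<epsilon> / 5))\<^sup>2" using s by (intro power_mono) (auto simp: s_def)
  then have "4 * s\<^sup>2 < \<epsilon>" using \<epsilon>_pos by simp
  moreover have "z \<in> D \<longleftrightarrow> ht z + \<phi> ((norm (rest_coords z))\<^sup>2) < 0" if "norm z < 2 * s" for z
  proof -
    have "z \<in> U" using that s r by (auto simp: subset_iff)
    then show ?thesis using DU by (auto simp: norm_rest_coords_square set_eq_iff)
  qed
  ultimately have "flat_boundary \<phi> (deriv \<phi>) \<epsilon> D s"
    by unfold_locales (use s assms(1) in auto)
  then show thesis using that by blast
qed

theorem theorem1p3:
  fixes D :: "(complex ^ ('n::finite option)) set"
    and \<gamma> :: "real \<Rightarrow> complex ^ ('n option)"
    and \<alpha> N :: real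
  assumes "open D" and "connected D"
    and "0 \<in> frontier D"
    and "exponentially_flat_boundary_point D"
    and "\<alpha> > 0" and "N > 0"
    and "cone_type_stream D \<alpha> N \<gamma>"
  shows "((\<lambda>t. kobayashi_eisenman D (\<gamma> t) /
      (normal_distance D (\<gamma> t) powi (- 2) *
       tangential_distance D (\<gamma> t) powi (- 2 * int CARD('n)))) \<longlongrightarrow> 1 / 4) (at_right 0)"
proof -
  obtain \<phi> \<epsilon> s where "flat_boundary \<phi> (deriv \<phi>) \<epsilon> D s"
    using exponentially_flat_imp_flat_boundary assms by blast
  then interpret flat_boundary \<phi> "deriv \<phi>" \<epsilon> D s .
  obtain \<epsilon>0 where "\<epsilon>0 > 0" "\<gamma> ` {0<..<\<epsilon>0} \<subseteq> D \<inter> cone \<alpha> N" and lim: "(\<gamma> \<longlongrightarrow> 0) (at_right 0)"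
    using assms(7) by (auto simp: cone_type_stream_def)
  then have "\<forall>\<^sub>F t in at_right 0. \<gamma> t \<in> cone \<alpha> N"
    unfolding eventually_at_right_field by (intro exI[of _ \<epsilon>0]) auto
  then show ?thesis
    using volume_ratio_tendsto[OF lim _ \<open>\<alpha> > 0\<close> \<open>N > 0\<close>] by (simp add: volume_ratio_def)
qed

end
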